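(* Suppose that $k$ and $s$ are constants and $c=\Theta(n^{-\alpha})$ for some $\alpha\in(0,1)$. Let $\tau$ be the largest integer satisfying $\alpha\binom{\tau}{s-1}<1$. Then: (1) If $k\ge\tau+1$, there is an $\tilde O\left(n^{\tau+2-\alpha\binom{\tau+1}{s}}\right)$ time randomized algorithm solving $\#(k,s)$-CLIQUE on inputs sampled from $G(n,c,s)$ with probability at least $1-n^{-\omega(1)}$. (2) If $k<\tau+1$, there is an $\tilde O\left(n^{k+1-\alpha\binom{k}{s}}\right)$ time randomized algorithm solving $\#(k,s)$-CLIQUE on inputs sampled from $G(n,c,s)$ with probability at least $1-n^{-\omega(1)}$.
   Context: Here $2\le s\le k$ are integers. A $k$-clique in an $s$-uniform hypergraph $G=(V(G),E(G))$ is a $k$-subset $W\subset V(G)$ with $\binom{W}{s}\subseteq E(G)$. $\#(k,s)$-CLIQUE is the problem of counting the number of $k$-cliques of a given $s$-uniform hypergraph. $G(n,c,s)$ is the Erdős–Rényi distribution on $s$-uniform hypergraphs on $n$ vertices, in which each of the $\binom{n}{s}$ possible hyperedges is included independently with probability $c$. The success probability is over both the input and the algorithm's random bits. $\tilde O$ hides $\mathrm{polylog}(n)$ factors, and $n^{-\omega(1)}$ denotes a quantity decaying faster than any fixed polynomial in $1/n$. *)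

theory Defs
  imports
    "HOL-Probability.Probability"
    "HOL-Library.Ramsey"
    "HOL-Library.Log_Nat"
    "HOL-Library.Landau_Symbols"
begin

subsection \<open>Hypergraphs and cliques\<close>

definition uniform_hypergraph :: "'v set \<Rightarrow> 'v set set \<Rightarrow> nat \<Rightarrow> bool" where
  "uniform_hypergraph V E s \<longleftrightarrow> finite V \<and> E \<subseteq> nsets V s"

definition cliques :: "'v set \<Rightarrow> 'v set set \<Rightarrow> nat \<Rightarrow> nat \<Rightarrow> 'v set set" where
  "cliques V E s k = {W \<in> nsets V k. nsets W s \<subseteq> E}"

definition num_cliques :: "'v set \<Rightarrow> 'v set set \<Rightarrow> nat \<Rightarrow> nat \<Rightarrow> nat" where
  "num_cliques V E s k = card (cliques V E s k)"

definition ER_hypergraph :: "nat \<Rightarrow> real \<Rightarrow> nat \<Rightarrow> nat set set pmf" where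
  "ER_hypergraph n p s =
     map_pmf (\<lambda>f. {e \<in> nsets {..<n} s. f e})
       (Pi_pmf (nsets {..<n} s) False (\<lambda>_. bernoulli_pmf p))"


subsection \<open>Randomized random access machines\<close>

text \<open>
  Programs are structured programs for a random access machine with the logarithmic cost
  criterion. The machine has registers, named by constants in the program text, and a memory that
  is addressed indirectly, through the contents of registers. All cells hold natural numbers.
\<close>

datatype binop = Add | Sub | Mul | Div

fun binop_sem :: "binop \<Rightarrow> nat \<Rightarrow> nat \<Rightarrow> nat" where
  "binop_sem Add x y = x + y"
| "binop_sem Sub x y = x - y"
| "binop_sem Mul x y = x * y"
| "binop_sem Div x y = x div y"

datatype com =
    Const nat nat             \<comment> \<open>\<open>Const i v\<close>: register \<open>i\<close> becomes \<open>v\<close>\<close>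
  | Op binop nat nat nat      \<comment> \<open>\<open>Op f i j l\<close>: register \<open>i\<close> becomes \<open>f\<close> of registers \<open>j\<close> and \<open>l\<close>\<close>
  | Load nat nat              \<comment> \<open>\<open>Load i j\<close>: register \<open>i\<close> becomes the cell addressed by register \<open>j\<close>\<close>
  | Store nat nat             \<comment> \<open>\<open>Store i j\<close>: the cell addressed by register \<open>j\<close> becomes register \<open>i\<close>\<close>
  | Coin nat                  \<comment> \<open>\<open>Coin i\<close>: register \<open>i\<close> becomes a fresh uniformly random bit\<close>
  | Skip
  | Seq com com
  | If nat com com            \<comment> \<open>tests whether the register is nonzero\<close>
  | While nat com

text \<open>
  A configuration consists of the stack of commands still to be executed, the registers, the
  memory, and the cost accumulated so far. The machine has halted when the stack is empty.
\<close>

type_synonym config = "com list \<times> (nat \<Rightarrow> nat) \<times> (nat \<Rightarrow> nat) \<times> nat"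

abbreviation len :: "nat \<Rightarrow> nat" where
  "len x \<equiv> floorlog 2 x"

text \<open>
  Every step costs one plus the binary lengths of the numbers it handles, including memory
  addresses and results.
\<close>

fun step :: "config \<Rightarrow> config pmf" where
  "step ([], R, M, t) = return_pmf ([], R, M, t)"
| "step (Const i v # K, R, M, t) =
     return_pmf (K, R(i := v), M, t + 1 + len v)"
| "step (Op f i j l # K, R, M, t) =
     return_pmf (K, R(i := binop_sem f (R j) (R l)), M,
       t + 1 + len (R j) + len (R l) + len (binop_sem f (R j) (R l)))"
| "step (Load i j # K, R, M, t) =
     return_pmf (K, R(i := M (R j)), M, t + 1 + len (R j) + len (M (R j)))"
| "step (Store i j # K, R, M, t) =
     return_pmf (K, R, M(R j := R i), t + 1 + len (R j) + len (R i))"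
| "step (Coin i # K, R, M, t) =
     map_pmf (\<lambda>b. (K, R(i := of_bool b), M, t + 1)) (bernoulli_pmf (1/2))"
| "step (Skip # K, R, M, t) = return_pmf (K, R, M, t + 1)"
| "step (Seq p q # K, R, M, t) = return_pmf (p # q # K, R, M, t + 1)"
| "step (If i p q # K, R, M, t) =
     return_pmf ((if R i \<noteq> 0 then p else q) # K, R, M, t + 1 + len (R i))"
| "step (While i p # K, R, M, t) =
     return_pmf (if R i \<noteq> 0 then p # While i p # K else K, R, M, t + 1 + len (R i))"

fun steps :: "nat \<Rightarrow> config \<Rightarrow> config pmf" where
  "steps 0 cf = return_pmf cf"
| "steps (Suc N) cf = bind_pmf (step cf) (steps N)"

text \<open>
  An \<open>s\<close>-uniform hypergraph on the vertices \<open>0, \<dots>, n - 1\<close> is presented to the machine as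
  its adjacency tensor: register 0 holds \<open>n\<close>, and the cell with address
  \<open>\<Sum>i<s. v i * n ^ i\<close> (where \<open>v i < n\<close>) holds 1 if \<open>{v i | i. i < s}\<close> is a hyperedge and 0
  otherwise. The output is read off register 0.
\<close>

definition input_mem :: "nat \<Rightarrow> nat \<Rightarrow> nat set set \<Rightarrow> nat \<Rightarrow> nat" where
  "input_mem s n E a = of_bool (a < n ^ s \<and> (\<lambda>i. a div n ^ i mod n) ` {..<s} \<in> E)"

definition init_config :: "com \<Rightarrow> nat \<Rightarrow> nat \<Rightarrow> nat set set \<Rightarrow> config" where
  "init_config P s n E = ([P], (\<lambda>_. 0)(0 := n), input_mem s n E, 0)"

text \<open>
  Worst-case running time, over all inputs and all random bits. As every step costs at least one,
  a run of total cost at most \<open>T n\<close> has halted after \<open>T n\<close> steps.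
\<close>

definition runs_in_time :: "com \<Rightarrow> nat \<Rightarrow> (nat \<Rightarrow> nat) \<Rightarrow> bool" where
  "runs_in_time P s T \<longleftrightarrow>
     (\<forall>n E. uniform_hypergraph {..<n} E s \<longrightarrow>
        (\<forall>(K, R, M, t) \<in> set_pmf (steps (T n) (init_config P s n E)). K = [] \<and> t \<le> T n))"

definition output_pmf :: "com \<Rightarrow> nat \<Rightarrow> (nat \<Rightarrow> nat) \<Rightarrow> nat \<Rightarrow> nat set set \<Rightarrow> nat pmf" where
  "output_pmf P s T n E = map_pmf (\<lambda>(K, R, M, t). R 0) (steps (T n) (init_config P s n E))"

definition success_prob ::
    "com \<Rightarrow> nat \<Rightarrow> nat \<Rightarrow> (nat \<Rightarrow> nat) \<Rightarrow> (nat \<Rightarrow> real) \<Rightarrow> nat \<Rightarrow> real" where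
  "success_prob P k s T c n =
     measure_pmf.prob
       (do {
          E \<leftarrow> ER_hypergraph n (c n) s;
          out \<leftarrow> output_pmf P s T n E;
          return_pmf (out = num_cliques {..<n} E s k)
        })
       {True}"


subsection \<open>Asymptotics\<close>

definition soft_O :: "(nat \<Rightarrow> real) \<Rightarrow> (nat \<Rightarrow> real) set" where
  "soft_O f = {g. \<exists>d::nat. g \<in> O(\<lambda>n. f n * ln (real n) ^ d)}"

definition negligible_fun :: "(nat \<Rightarrow> real) \<Rightarrow> bool" where
  "negligible_fun \<epsilon> \<longleftrightarrow> (\<forall>d::nat. \<epsilon> \<in> O(\<lambda>n. 1 / real n ^ d))"

end

theory Submission
  imports Defs "HOL-Real_Asymp.Real_Asymp"
begin

text \<open>
  The algorithm extends ordered cliques vertex by vertex. Once a clique has at least \<open>s - 1\<close>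
  vertices, its candidate extensions are read off the neighbourhood of its last \<open>s - 1\<close> vertices,
  of which there are only about \<open>n powr (1 - \<alpha>)\<close>. With very high probability every \<open>j\<close>-set has at most
  \<open>n powr (\<delta> + max 0 (1 - \<alpha> * (j choose (s - 1))))\<close> common extensions (a union bound over the sets of
  possible extensions), and multiplying these bounds controls the number of cliques of every size at
  once. The number of \<open>\<kappa>\<close>-cliques dominates for \<open>\<kappa> = min k (\<tau> + 1)\<close>, the point
  where the increments \<open>1 - \<alpha> * (j choose (s - 1))\<close> of the exponent stop being positive.

  The work is thus smaller than the claimed time by a power of \<open>n\<close>. This slack is
  essential: a worst-case running time requires a cutoff that the program can compute, and
  \<open>\<alpha>\<close> is an arbitrary real number, so the cutoff is \<open>n powr (p / q)\<close> for a rational \<open>p / q\<close> strictly between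
  the two exponents.
\<close>

subsection \<open>Evaluation of deterministic programs\<close>

text \<open>Scanning all \<open>n\<close> vertices for every clique would give work of exponent one
  plus the sum of the positive increments, which is the claimed exponent with nothing to spare.
  Reading candidates off a neighbourhood replaces that extra \<open>1\<close> by
  \<open>1 - \<alpha>\<close>. Half of the gain \<open>\<alpha>\<close> pays for the
  \<open>k + 1\<close> losses of \<delta> that the concentration bounds cost, and the other half is
  the room for \<open>p / q\<close>. The cutoff is implemented as fuel. Running out of it ends every
  loop and spoils only the output, so the time bound holds on every hypergraph, while correctness is
  needed only on those with few extensions. The program is deterministic; \<open>c\<close>, \<alpha>
  and \<tau> enter it only through the fixed integers \<open>p\<close> and \<open>q\<close>.
  Building the lookup table takes \<open>n ^ s\<close> iterations, which is affordable because
  \<open>s\<close> is below the claimed exponent.\<close>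

text \<open>
  The number before the final state counts loop iterations only; the number of steps is recovered
  from it through the size of the program. Every value that is computed has to be at most \<open>D\<close>,
  so that a step costs \<open>O(log D)\<close>.
\<close>

inductive big :: "nat \<Rightarrow> com \<Rightarrow> (nat \<Rightarrow> nat) \<Rightarrow> (nat \<Rightarrow> nat) \<Rightarrow> nat \<Rightarrow> (nat \<Rightarrow> nat) \<Rightarrow> (nat \<Rightarrow> nat) \<Rightarrow> bool"
  for D where
  big_Const: "v \<le> D \<Longrightarrow> big D (Const i v) R M 0 (R(i := v)) M"
| big_Op: "binop_sem f (R j) (R l) \<le> D \<Longrightarrow> big D (Op f i j l) R M 0 (R(i := binop_sem f (R j) (R l))) M"
| big_Load: "big D (Load i j) R M 0 (R(i := M (R j))) M"
| big_Store: "big D (Store i j) R M 0 R (M(R j := R i))"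
| big_Skip: "big D Skip R M 0 R M"
| big_Seq: "big D p R M t R1 M1 \<Longrightarrow> big D q R1 M1 u R2 M2 \<Longrightarrow> big D (Seq p q) R M (t + u) R2 M2"
| big_If: "big D (if R i \<noteq> 0 then p else q) R M t R1 M1 \<Longrightarrow> big D (If i p q) R M t R1 M1"
| big_While_end: "R i = 0 \<Longrightarrow> big D (While i p) R M 0 R M"
| big_While_step: "R i \<noteq> 0 \<Longrightarrow> big D p R M t R1 M1 \<Longrightarrow> big D (While i p) R1 M1 u R2 M2
    \<Longrightarrow> big D (While i p) R M (Suc (t + u)) R2 M2"

fun com_size :: "com \<Rightarrow> nat" where
  "com_size (Seq p q) = com_size p + com_size q + 1"
| "com_size (If i p q) = com_size p + com_size q + 1"
| "com_size (While i p) = com_size p + 1"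
| "com_size _ = 1"

lemma steps_add: "steps (m + n) cf = bind_pmf (steps m cf) (steps n)"
proof (induction m arbitrary: cf)
  case (Suc m)
  then have "steps (m + n) = (\<lambda>cf. bind_pmf (steps m cf) (steps n))" by (rule ext)
  then show ?case by (simp add: bind_assoc_pmf)
qed (simp add: bind_return_pmf)

lemma steps_chain:
  "steps m cf = return_pmf cf' \<Longrightarrow> steps n cf' = X \<Longrightarrow> steps (m + n) cf = X"
  by (simp add: steps_add bind_return_pmf)

lemma steps_single: "step cf = return_pmf cf' \<Longrightarrow> steps 1 cf = return_pmf cf'"
  by (simp add: bind_return_pmf)

lemma steps_halted: "steps n ([], R, M, t) = return_pmf ([], R, M, t)"
  by (induction n) (simp_all add: bind_return_pmf)

lemma big_bounded:
  assumes "big D p R M u R' M'" "\<And>x. R x \<le> D" "\<And>x. M x \<le> D"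
  shows "(\<forall>x. R' x \<le> D) \<and> (\<forall>x. M' x \<le> D)"
  using assms by (induction rule: big.induct) auto

text \<open>Between loop iterations control only moves forward in the program text, so
  \<open>u + 1\<close> passes over the text bound the steps. A step handles at most three numbers,
  each at most \<open>D\<close>, whence the factor \<open>1 + 3 * len D\<close>.\<close>

lemma big_sound:
  assumes "big D p R M u R' M'" "\<And>x. R x \<le> D" "\<And>x. M x \<le> D"
  shows "\<exists>m c. m \<le> com_size p * (u + 1) \<and> c \<le> m * (1 + 3 * len D) \<and>
       (\<forall>K t. steps m (p # K, R, M, t) = return_pmf (K, R', M', t + c))"
    (is "\<exists>m c. ?P p u R M R' M' m c")
  using assms
proof (induction rule: big.induct)
  case (big_Const v i R M)
  then have "?P (Const i v) 0 R M (R(i := v)) M 1 (1 + len v)"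
    using floorlog_mono[of v D 2] by (auto simp: bind_return_pmf)
  then show ?case by blast
next
  case (big_Op f R j l i M)
  then have "?P (Op f i j l) 0 R M (R(i := binop_sem f (R j) (R l))) M 1
     (1 + len (R j) + len (R l) + len (binop_sem f (R j) (R l)))"
    using floorlog_mono[of "R j" D 2] floorlog_mono[of "R l" D 2]
      floorlog_mono[of "binop_sem f (R j) (R l)" D 2]
    by (auto simp: bind_return_pmf add.assoc)
  then show ?case by blast
next
  case (big_Load i j R M)
  then have "?P (Load i j) 0 R M (R(i := M (R j))) M 1 (1 + len (R j) + len (M (R j)))"
    using floorlog_mono[of "R j" D 2] floorlog_mono[of "M (R j)" D 2]
    by (auto simp: bind_return_pmf add.assoc)
  then show ?case by blast
next
  case (big_Store i j R M)
  then have "?P (Store i j) 0 R M R (M(R j := R i)) 1 (1 + len (R j) + len (R i))"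
    using floorlog_mono[of "R j" D 2] floorlog_mono[of "R i" D 2]
    by (auto simp: bind_return_pmf add.assoc)
  then show ?case by blast
next
  case (big_Skip R M)
  have "?P Skip 0 R M R M 1 1" by (auto simp: bind_return_pmf)
  then show ?case by blast
next
  case (big_Seq p R M t R1 M1 q u R2 M2)
  have "\<forall>x. R1 x \<le> D" "\<forall>x. M1 x \<le> D"
    using big_bounded[OF big_Seq.hyps(1)] big_Seq.prems by auto
  with big_Seq obtain m c m' c' where 1: "?P p t R M R1 M1 m c" and 2: "?P q u R1 M1 R2 M2 m' c'"
    by blast
  have "steps (1 + (m + m')) (Seq p q # K, R, M, v) = return_pmf (K, R2, M2, v + (1 + c + c'))" for K v
    by (rule steps_chain, rule steps_single, simp, rule steps_chain, use 1 in blast)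
      (use 2 in \<open>auto simp: add.assoc\<close>)
  moreover have "1 + (m + m') \<le> com_size (Seq p q) * (t + u + 1)"
  proof -
    have "com_size p * (t + 1) \<le> com_size p * (t + u + 1)"
      "com_size q * (u + 1) \<le> com_size q * (t + u + 1)"
      by (intro mult_le_mono2; simp)+
    with 1 2 show ?thesis by (simp add: algebra_simps)
  qed
  moreover have "1 + c + c' \<le> (1 + (m + m')) * (1 + 3 * len D)"
    using 1 2 by (simp add: algebra_simps)
  ultimately show ?case by blast
next
  case (big_If R i p q M t R1 M1)
  then obtain m c where 1: "?P (if R i \<noteq> 0 then p else q) t R M R1 M1 m c"
    by blast
  have "steps (1 + m) (If i p q # K, R, M, v) = return_pmf (K, R1, M1, v + (1 + len (R i) + c))" for K v
    by (rule steps_chain, rule steps_single, simp) (use 1 in \<open>auto simp: add.assoc\<close>)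
  moreover have "1 + m \<le> com_size (If i p q) * (t + 1)"
    using 1 by (auto simp: algebra_simps split: if_splits)
  moreover have "1 + len (R i) + c \<le> (1 + m) * (1 + 3 * len D)"
    using 1 floorlog_mono[of "R i" D 2] big_If.prems(1)[of i] by (simp add: algebra_simps)
  ultimately show ?case by blast
next
  case (big_While_end R i p M)
  then have "?P (While i p) 0 R M R M 1 1"
    by (auto simp: bind_return_pmf floorlog_def)
  then show ?case by blast
next
  case (big_While_step R i p M t R1 M1 u R2 M2)
  have "\<forall>x. R1 x \<le> D" "\<forall>x. M1 x \<le> D"
    using big_bounded[OF big_While_step.hyps(2)] big_While_step.prems by auto
  with big_While_step obtain m c m' c' where
    1: "?P p t R M R1 M1 m c" and 2: "?P (While i p) u R1 M1 R2 M2 m' c'"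
    by blast
  have "steps (1 + (m + m')) (While i p # K, R, M, v) = return_pmf (K, R2, M2, v + (1 + len (R i) + c + c'))" for K v
    by (rule steps_chain, rule steps_single, simp add: big_While_step.hyps, rule steps_chain, use 1 in blast)
      (use 2 in \<open>auto simp: add.assoc\<close>)
  moreover have "1 + (m + m') \<le> com_size (While i p) * (Suc (t + u) + 1)"
    using 1 2 by (simp add: algebra_simps)
  moreover have "1 + len (R i) + c + c' \<le> (1 + (m + m')) * (1 + 3 * len D)"
    using 1 2 floorlog_mono[of "R i" D 2] big_While_step.prems(1)[of i] by (simp add: algebra_simps)
  ultimately show ?case by blast
qed

text \<open>A total-correctness precondition: \<open>big\<close> has no rule for
  \<open>Coin\<close>, and the existential asserts termination. The counter \<open>t\<close> is a
  ghost variable through which loop invariants can speak of the iterations made so far.\<close>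

definition wp :: "nat \<Rightarrow> com \<Rightarrow> ((nat \<Rightarrow> nat) \<Rightarrow> (nat \<Rightarrow> nat) \<Rightarrow> nat \<Rightarrow> bool) \<Rightarrow> (nat \<Rightarrow> nat) \<Rightarrow> (nat \<Rightarrow> nat) \<Rightarrow> nat \<Rightarrow> bool"
  where "wp D p Q R M t \<longleftrightarrow> (\<exists>u R' M'. big D p R M u R' M' \<and> Q R' M' (t + u))"

lemma wp_Const [simp]: "wp D (Const i v) Q R M t \<longleftrightarrow> v \<le> D \<and> Q (R(i := v)) M t"
proof -
  have "big D (Const i v) R M u R' M' \<longleftrightarrow> v \<le> D \<and> u = 0 \<and> R' = R(i := v) \<and> M' = M" for u R' M'
    by (auto intro: big.intros elim: big.cases)
  then show ?thesis by (auto simp: wp_def)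
qed

lemma wp_Op [simp]: "wp D (Op f i j l) Q R M t \<longleftrightarrow>
    binop_sem f (R j) (R l) \<le> D \<and> Q (R(i := binop_sem f (R j) (R l))) M t"
proof -
  have "big D (Op f i j l) R M u R' M' \<longleftrightarrow>
      binop_sem f (R j) (R l) \<le> D \<and> u = 0 \<and> R' = R(i := binop_sem f (R j) (R l)) \<and> M' = M" for u R' M'
    by (auto intro: big.intros elim: big.cases)
  then show ?thesis by (auto simp: wp_def)
qed

lemma wp_Load [simp]: "wp D (Load i j) Q R M t \<longleftrightarrow> Q (R(i := M (R j))) M t"
proof -
  have "big D (Load i j) R M u R' M' \<longleftrightarrow> u = 0 \<and> R' = R(i := M (R j)) \<and> M' = M" for u R' M'
    by (auto intro: big.intros elim: big.cases)
  then show ?thesis by (auto simp: wp_def)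
qed

lemma wp_Store [simp]: "wp D (Store i j) Q R M t \<longleftrightarrow> Q R (M(R j := R i)) t"
proof -
  have "big D (Store i j) R M u R' M' \<longleftrightarrow> u = 0 \<and> R' = R \<and> M' = M(R j := R i)" for u R' M'
    by (auto intro: big.intros elim: big.cases)
  then show ?thesis by (auto simp: wp_def)
qed

lemma wp_Skip [simp]: "wp D Skip Q R M t \<longleftrightarrow> Q R M t"
proof -
  have "big D Skip R M u R' M' \<longleftrightarrow> u = 0 \<and> R' = R \<and> M' = M" for u R' M'
    by (auto intro: big.intros elim: big.cases)
  then show ?thesis by (auto simp: wp_def)
qed

lemma wp_Seq [simp]: "wp D (Seq p q) Q = wp D p (wp D q Q)"
proof (intro ext iffI)
  fix R M t
  assume "wp D (Seq p q) Q R M t"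
  then obtain u R' M' where "big D (Seq p q) R M u R' M'" "Q R' M' (t + u)"
    by (auto simp: wp_def)
  then show "wp D p (wp D q Q) R M t"
    unfolding wp_def by (cases rule: big.cases) (metis add.assoc)
next
  fix R M t
  assume "wp D p (wp D q Q) R M t"
  then show "wp D (Seq p q) Q R M t"
    unfolding wp_def by (metis big_Seq add.assoc)
qed

lemma wp_If [simp]: "wp D (If i p q) Q R M t \<longleftrightarrow> wp D (if R i \<noteq> 0 then p else q) Q R M t"
proof -
  have "big D (If i p q) R M u R' M' \<longleftrightarrow> big D (if R i \<noteq> 0 then p else q) R M u R' M'" for u R' M'
    by (auto intro: big_If elim: big.cases)
  then show ?thesis by (simp add: wp_def)
qed

lemma wp_mono:
  assumes "wp D p Q R M t" "\<And>R' M' t'. Q R' M' t' \<Longrightarrow> Q' R' M' t'"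
  shows "wp D p Q' R M t"
  using assms unfolding wp_def by blast

text \<open>An iteration is charged before its body is executed, hence \<open>Suc t\<close>. The
  measure reads registers only, as every loop of the program is bounded by one.\<close>

lemma wp_While:
  fixes \<mu> :: "(nat \<Rightarrow> nat) \<Rightarrow> nat"
  assumes "I R M t"
    and "\<And>R M t. I R M t \<Longrightarrow> R i \<noteq> 0 \<Longrightarrow> wp D p (\<lambda>R' M' t'. I R' M' t' \<and> \<mu> R' < \<mu> R) R M (Suc t)"
  shows "wp D (While i p) (\<lambda>R M t. I R M t \<and> R i = 0) R M t"
  using assms(1)
proof (induction "\<mu> R" arbitrary: R M t rule: less_induct)
  case less
  show ?case
  proof (cases "R i = 0")
    case True
    with less show ?thesis
      unfolding wp_def by (metis add_0_right big_While_end)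
  next
    case False
    from assms(2)[OF less.prems False] obtain u R1 M1 where
      1: "big D p R M u R1 M1" "I R1 M1 (Suc t + u)" "\<mu> R1 < \<mu> R"
      unfolding wp_def by blast
    from less.hyps[OF 1(3,2)] obtain u' R2 M2 where
      2: "big D (While i p) R1 M1 u' R2 M2" "I R2 M2 (Suc t + u + u')" "R2 i = 0"
      unfolding wp_def by blast
    have "t + Suc (u + u') = Suc t + u + u'" by simp
    then show ?thesis
      using big_While_step[where D = D, OF False 1(1) 2(1)] 2(2,3) unfolding wp_def by metis
  qed
qed

text \<open>A halted configuration is a fixed point of \<open>step\<close>, so a run that ends early
  can be padded to exactly \<open>T\<close> steps.\<close>

lemma wp_steps:
  assumes "wp D p (\<lambda>R' M' u. u \<le> U \<and> Q (R' 0)) R M 0"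
    and "\<And>x. R x \<le> D" "\<And>x. M x \<le> D"
    and T: "T = com_size p * (U + 1) * (1 + 3 * len D)"
  shows "\<exists>R' M' t'. steps T ([p], R, M, 0) = return_pmf ([], R', M', t') \<and> t' \<le> T \<and> Q (R' 0)"
proof -
  obtain u R' M' where u: "big D p R M u R' M'" "u \<le> U" "Q (R' 0)"
    using assms(1) by (auto simp: wp_def)
  obtain m c where mc: "m \<le> com_size p * (u + 1)" "c \<le> m * (1 + 3 * len D)"
    "steps m ([p], R, M, 0) = return_pmf ([], R', M', c)"
    using big_sound[OF u(1) assms(2,3)] by force
  have "m \<le> com_size p * (U + 1)"
    using mc(1) u(2) by (meson add_le_mono1 le_trans mult_le_mono2)
  then have "m * (1 + 3 * len D) \<le> T"
    unfolding T by (rule mult_le_mono1)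
  moreover have "m \<le> m * (1 + 3 * len D)" by simp
  ultimately have le: "c \<le> T" "m \<le> T" using mc(2) by linarith+
  have "steps (m + (T - m)) ([p], R, M, 0) = return_pmf ([], R', M', c)"
    by (rule steps_chain[OF mc(3) steps_halted])
  with le u(3) show ?thesis by auto
qed

subsection \<open>Addresses and ordered cliques\<close>

text \<open>Horner evaluation makes the last element the least significant digit. This reverses the
  digit order of the input format, which is harmless because \<open>input_mem\<close> depends only
  on the set of digits.\<close>

definition addr :: "nat \<Rightarrow> nat list \<Rightarrow> nat" where
  "addr n xs = foldl (\<lambda>a x. a * n + x) 0 xs"

lemma addr_Nil [simp]: "addr n [] = 0"
  by (simp add: addr_def)

lemma addr_snoc [simp]: "addr n (xs @ [x]) = addr n xs * n + x"
  by (simp add: addr_def)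

lemma mult_add_less_power:
  fixes a x n :: nat
  assumes "a < n ^ i" "x < n"
  shows "a * n + x < n ^ Suc i"
proof -
  have "a * n + x < Suc a * n" using assms(2) by simp
  also have "\<dots> \<le> n ^ i * n" using assms(1) by (intro mult_le_mono1) simp
  finally show ?thesis by (simp add: mult.commute)
qed

lemma addr_less: "set xs \<subseteq> {..<n} \<Longrightarrow> addr n xs < n ^ length xs"
proof (induction xs rule: rev_induct)
  case (snoc x xs)
  then show ?case using mult_add_less_power[of "addr n xs" n "length xs" x] by simp
qed simp

lemma addr_digits:
  "set xs \<subseteq> {..<n} \<Longrightarrow> (\<lambda>i. addr n xs div n ^ i mod n) ` {..<length xs} = set xs"
proof (induction xs rule: rev_induct)
  case (snoc x xs)
  then have x: "x < n" by simp
  have "addr n (xs @ [x]) div n ^ Suc i mod n = addr n xs div n ^ i mod n" for i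
    using x by (simp add: div_mult2_eq)
  moreover have "addr n (xs @ [x]) div n ^ 0 mod n = x"
    using x by simp
  ultimately have "(\<lambda>i. addr n (xs @ [x]) div n ^ i mod n) ` {..<Suc (length xs)} =
      insert x ((\<lambda>i. addr n xs div n ^ i mod n) ` {..<length xs})"
    by (simp only: lessThan_Suc_eq_insert_0 image_insert image_image)
  with snoc show ?case by simp
qed simp

lemma input_mem_addr:
  assumes "length xs = s" "set xs \<subseteq> {..<n}"
  shows "input_mem s n E (addr n xs) = of_bool (set xs \<in> E)"
  using addr_less[OF assms(2)] addr_digits[OF assms(2)] assms(1) by (simp add: input_mem_def)

section \<open>Extensions of ordered cliques\<close>

lemma nsets_insert_Suc:
  assumes "x \<notin> A" "finite A"
  shows "nsets (insert x A) (Suc m) = nsets A (Suc m) \<union> insert x ` nsets A m"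
proof (intro equalityI subsetI)
  fix Y assume Y: "Y \<in> nsets (insert x A) (Suc m)"
  show "Y \<in> nsets A (Suc m) \<union> insert x ` nsets A m"
  proof (cases "x \<in> Y")
    case True
    with Y have "Y - {x} \<in> nsets A m" "Y = insert x (Y - {x})"
      by (auto simp: nsets_def)
    then show ?thesis by blast
  next
    case False
    with Y show ?thesis by (auto simp: nsets_def)
  qed
next
  fix Y assume "Y \<in> nsets A (Suc m) \<union> insert x ` nsets A m"
  with assms show "Y \<in> nsets (insert x A) (Suc m)"
    by (auto simp: nsets_def card_insert_if)
qed

text \<open>For the vertex set \<open>A\<close> of an ordered clique these are the
  \<open>m\<close>-cliques in the search tree below it. Asking new vertices to exceed all of
  \<open>A\<close> puts each clique on one branch only.\<close>

definition extensions :: "nat \<Rightarrow> nat set set \<Rightarrow> nat \<Rightarrow> nat set \<Rightarrow> nat \<Rightarrow> nat set set" where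
  "extensions n E s A m = {W \<in> cliques {..<n} E s m. A \<subseteq> W \<and> (\<forall>x\<in>W - A. \<forall>a\<in>A. a < x)}"

lemma finite_extensions [simp]: "finite (extensions n E s A m)"
  unfolding extensions_def cliques_def by (simp add: finite_imp_finite_nsets)

lemma extensions_empty: "extensions n E s {} m = cliques {..<n} E s m"
  by (simp add: extensions_def)

definition ordered_clique :: "nat \<Rightarrow> nat set set \<Rightarrow> nat \<Rightarrow> nat list \<Rightarrow> bool" where
  "ordered_clique n E s vs \<longleftrightarrow>
     sorted_wrt (<) vs \<and> set vs \<subseteq> {..<n} \<and> nsets (set vs) s \<subseteq> E"

definition first_vertex :: "nat list \<Rightarrow> nat" where
  "first_vertex vs = (if vs = [] then 0 else Suc (last vs))"

text \<open>
  A candidate forms an edge with the last \<open>s - 1\<close> vertices; \<open>joined\<close> tests all the other edges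
  as well.
\<close>

definition candidate :: "nat set set \<Rightarrow> nat \<Rightarrow> nat list \<Rightarrow> nat \<Rightarrow> bool" where
  "candidate E s vs w \<longleftrightarrow>
     (s - 1 \<le> length vs \<longrightarrow> insert w (set (drop (length vs - (s - 1)) vs)) \<in> E)"

definition candidates :: "nat \<Rightarrow> nat set set \<Rightarrow> nat \<Rightarrow> nat list \<Rightarrow> nat set" where
  "candidates n E s vs = {w. first_vertex vs \<le> w \<and> w < n \<and> candidate E s vs w}"

definition joined :: "nat set set \<Rightarrow> nat \<Rightarrow> nat list \<Rightarrow> nat \<Rightarrow> bool" where
  "joined E s vs w \<longleftrightarrow> (\<forall>U\<in>nsets (set vs) (s - 1). insert w U \<in> E)"

lemma finite_candidates [simp]: "finite (candidates n E s vs)"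
  by (simp add: candidates_def)

lemma sorted_wrt_less_first_vertex:
  assumes "sorted_wrt (<) (vs :: nat list)"
  shows "first_vertex vs \<le> w \<longleftrightarrow> (\<forall>v\<in>set vs. v < w)"
proof (cases vs rule: rev_cases)
  case (snoc us u)
  with assms show ?thesis by (auto simp: first_vertex_def sorted_wrt_append)
qed (simp add: first_vertex_def)

lemma ordered_clique_distinct: "ordered_clique n E s vs \<Longrightarrow> distinct vs"
  unfolding ordered_clique_def using strict_sorted_iff by blast

lemma ordered_clique_snoc:
  assumes "ordered_clique n E s vs" "first_vertex vs \<le> w" "w < n" "1 \<le> s"
  shows "ordered_clique n E s (vs @ [w]) \<longleftrightarrow> joined E s vs w"
proof -
  have lt: "\<forall>v\<in>set vs. v < w"
    using assms sorted_wrt_less_first_vertex unfolding ordered_clique_def by blast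
  then have "w \<notin> set vs" by auto
  from nsets_insert_Suc[OF this, of "s - 1"] assms(4)
  have "nsets (insert w (set vs)) s = nsets (set vs) s \<union> insert w ` nsets (set vs) (s - 1)"
    by simp
  with lt assms show ?thesis
    by (auto simp: ordered_clique_def joined_def sorted_wrt_append)
qed

lemma extensions_length:
  assumes "ordered_clique n E s vs"
  shows "extensions n E s (set vs) (length vs) = {set vs}"
proof -
  have "card (set vs) = length vs"
    using ordered_clique_distinct[OF assms] distinct_card by blast
  moreover have "W = set vs" if "W \<in> extensions n E s (set vs) (length vs)" for W
  proof -
    have "finite W" "card W = length vs" "set vs \<subseteq> W"
      using that by (auto simp: extensions_def cliques_def nsets_def)
    then show ?thesis using card_subset_eq \<open>card (set vs) = length vs\<close> by metis
  qed
  ultimately show ?thesis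
    using assms by (auto simp: extensions_def cliques_def nsets_def ordered_clique_def)
qed

text \<open>Extensions are classified by their least new vertex. It forms an edge with every
  \<open>(s - 1)\<close>-subset of \<open>vs\<close>, in particular with the last
  \<open>s - 1\<close> vertices, so it passes the candidate test.\<close>

lemma extensions_UN:
  assumes vs: "ordered_clique n E s vs" and m: "length vs < m" and s: "1 \<le> s"
  shows "extensions n E s (set vs) m =
    (\<Union>w\<in>{w \<in> candidates n E s vs. joined E s vs w}. extensions n E s (insert w (set vs)) m)"
    (is "?L = (\<Union>w\<in>?S. ?X w)")
proof (intro equalityI subsetI)
  fix W assume W: "W \<in> ?L"
  then have W': "W \<subseteq> {..<n}" "finite W" "card W = m" "nsets W s \<subseteq> E" "set vs \<subseteq> W"
    "\<And>x a. x \<in> W - set vs \<Longrightarrow> a \<in> set vs \<Longrightarrow> a < x"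
    by (auto simp: extensions_def cliques_def nsets_def)
  have "W - set vs \<noteq> {}"
  proof
    assume "W - set vs = {}"
    then have "card W \<le> length vs"
      using card_length[of vs] W'(5) by (metis Diff_eq_empty_iff subset_antisym)
    with m W' show False by simp
  qed
  define w where "w = Min (W - set vs)"
  have w: "w \<in> W - set vs" using Min_in[of "W - set vs"] \<open>W - set vs \<noteq> {}\<close> W' by (simp add: w_def)
  have min: "w \<le> x" if "x \<in> W - set vs" for x using that W' by (simp add: w_def)
  have sv: "sorted_wrt (<) vs" using vs by (simp add: ordered_clique_def)
  have first: "first_vertex vs \<le> w"
    using W'(6) w sorted_wrt_less_first_vertex[OF sv] by blast
  have ins: "insert w U \<in> E" if "U \<in> nsets (set vs) (s - 1)" for U
  proof -
    have "insert w U \<in> nsets W s"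
      using that w W'(5) s by (auto simp: nsets_def card_insert_if)
    with W'(4) show ?thesis by blast
  qed
  have "candidate E s vs w"
    unfolding candidate_def
  proof
    assume len: "s - 1 \<le> length vs"
    let ?u = "drop (length vs - (s - 1)) vs"
    have "distinct ?u" using ordered_clique_distinct[OF vs] by simp
    then have "card (set ?u) = s - 1" using distinct_card[of ?u] len by simp
    moreover have "set ?u \<subseteq> set vs" by (rule set_drop_subset)
    ultimately show "insert w (set ?u) \<in> E" by (intro ins) (simp add: nsets_def)
  qed
  with first w W' ins have "w \<in> ?S" by (auto simp: candidates_def joined_def)
  moreover have "W \<in> ?X w"
  proof -
    have "a < x" if "x \<in> W - insert w (set vs)" "a \<in> insert w (set vs)" for x a
      using that W'(6)[of x a] min[of x] by (cases "a = w") (auto simp: le_less)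
    then show ?thesis using W w unfolding extensions_def by blast
  qed
  ultimately show "W \<in> (\<Union>w\<in>?S. ?X w)" by blast
next
  fix W assume "W \<in> (\<Union>w\<in>?S. ?X w)"
  then obtain w where w: "w \<in> ?S" "W \<in> ?X w" by blast
  have "\<forall>v\<in>set vs. v < w"
    using w sorted_wrt_less_first_vertex vs unfolding ordered_clique_def candidates_def by blast
  with w show "W \<in> ?L" by (auto simp: extensions_def)
qed

text \<open>The classes are disjoint: two different least new vertices of one clique would each have
  to precede the other. The sum has an \<open>if\<close> because the loop visits all candidates and
  tests \<open>joined\<close> afterwards.\<close>

lemma card_extensions_sum:
  assumes vs: "ordered_clique n E s vs" and m: "length vs < m" and s: "1 \<le> s"
  shows "card (extensions n E s (set vs) m) = (\<Sum>w\<in>candidates n E s vs.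
     if joined E s vs w then card (extensions n E s (insert w (set vs)) m) else 0)"
proof -
  let ?S = "{w \<in> candidates n E s vs. joined E s vs w}"
  have notin: "w \<notin> set vs" if "w \<in> ?S" for w
    using that sorted_wrt_less_first_vertex[of vs w] vs
    by (auto simp: ordered_clique_def candidates_def)
  have disj: "extensions n E s (insert w (set vs)) m \<inter> extensions n E s (insert w' (set vs)) m = {}"
    if "w \<in> ?S" "w' \<in> ?S" "w \<noteq> w'" for w w'
  proof (rule ccontr)
    assume "\<not> ?thesis"
    then obtain W where "W \<in> extensions n E s (insert w (set vs)) m"
      "W \<in> extensions n E s (insert w' (set vs)) m" by blast
    then have "w < w'" "w' < w"
      using notin that by (auto simp: extensions_def)
    then show False by simp
  qed
  have "card (extensions n E s (set vs) m) = (\<Sum>w\<in>?S. card (extensions n E s (insert w (set vs)) m))"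
    unfolding extensions_UN[OF assms] by (rule card_UN_disjoint) (use disj in auto)
  also have "\<dots> = (\<Sum>w\<in>candidates n E s vs.
     if joined E s vs w then card (extensions n E s (insert w (set vs)) m) else 0)"
    by (rule sum.inter_filter) simp
  finally show ?thesis .
qed

subsection \<open>The search program\<close>

text \<open>
  Register 0 holds \<open>n\<close>, registers 1 and 2 the constants one and zero, register 3 the fuel, register 4
  the count, register 5 the table offset \<open>n ^ s\<close>; registers 6 to 9 are scratch, and register \<open>10 + j\<close>
  holds the vertex chosen at depth \<open>j\<close>.
\<close>

primrec mulpow :: "nat \<Rightarrow> nat \<Rightarrow> nat \<Rightarrow> com" where
  "mulpow i x 0 = Skip"
| "mulpow i x (Suc m) = Seq (Op Mul i i x) (mulpow i x m)"

lemma wp_mulpow: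
  assumes "i \<noteq> x" "R i * R x ^ m \<le> D" "Q (R(i := R i * R x ^ m)) M t"
  shows "wp D (mulpow i x m) Q R M t"
  using assms
proof (induction m arbitrary: R)
  case (Suc m)
  \<comment> \<open>A partial product is at most the full one unless the factor vanishes, and in
    that case it is already 0.\<close>
  have "R i * R x \<le> D"
  proof (cases "R x = 0")
    case False
    then have "R i * R x \<le> R i * R x * R x ^ m" by simp
    also have "\<dots> = R i * R x ^ Suc m" by simp
    finally show ?thesis using Suc.prems(2) by (rule order.trans)
  qed simp
  moreover have "wp D (mulpow i x m) Q (R(i := R i * R x)) M t"
    by (rule Suc.IH) (use Suc.prems in \<open>simp_all add: mult.assoc del: fun_upd_apply add: fun_upd_same fun_upd_other\<close>)
  ultimately show ?case by simp
qed simp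

primrec horner :: "nat list \<Rightarrow> com" where
  "horner [] = Skip"
| "horner (x # xs) = Seq (Op Mul 6 6 0) (Seq (Op Add 6 6 x) (horner xs))"

lemma wp_horner_aux:
  assumes "6 \<notin> set xs" "\<forall>x\<in>set xs. R x < R 0" "R 6 < R 0 ^ i" "i + length xs \<le> s" "R 0 ^ s \<le> D"
    "Q (R(6 := foldl (\<lambda>a x. a * R 0 + R x) (R 6) xs)) M t"
  shows "wp D (horner xs) Q R M t"
  using assms
proof (induction xs arbitrary: R i)
  case (Cons x xs)
  let ?v = "R 6 * R 0 + R x"
  have v: "?v < R 0 ^ Suc i"
    by (rule mult_add_less_power) (use Cons.prems in auto)
  have "R 0 ^ Suc i \<le> R 0 ^ s"
    by (rule power_increasing) (use Cons.prems in auto)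
  with v Cons.prems(5) have "?v \<le> D" by linarith
  moreover have "wp D (horner xs) Q (R(6 := ?v)) M t"
  proof (rule Cons.IH)
    show "Q ((R(6 := ?v))(6 := foldl (\<lambda>a x. a * (R(6 := ?v)) 0 + (R(6 := ?v)) x) ((R(6 := ?v)) 6) xs)) M t"
    proof -
      have "foldl (\<lambda>a x. a * (R(6 := ?v)) 0 + (R(6 := ?v)) x) b xs = foldl (\<lambda>a x. a * R 0 + R x) b xs" for b
        by (rule foldl_cong) (use Cons.prems(1) in auto)
      then show ?thesis using Cons.prems(6) by (simp del: fun_upd_apply add: fun_upd_same)
    qed
    show "(R(6 := ?v)) 6 < (R(6 := ?v)) 0 ^ Suc i" using v by simp
  qed (use Cons.prems in auto)
  ultimately show ?case using Cons.prems by simp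
qed (simp add: fun_upd_idem)

lemma wp_horner:
  assumes "6 \<notin> set xs" "\<forall>x\<in>set xs. R x < R 0" "R 6 = 0" "length xs \<le> s" "R 0 ^ s \<le> D"
    "Q (R(6 := addr (R 0) (map R xs))) M t"
  shows "wp D (horner xs) Q R M t"
  by (rule wp_horner_aux[of _ _ 0]) (use assms in \<open>simp_all add: addr_def foldl_map\<close>)

definition eqoff :: "nat set \<Rightarrow> (nat \<Rightarrow> nat) \<Rightarrow> (nat \<Rightarrow> nat) \<Rightarrow> bool" where
  "eqoff S R R' \<longleftrightarrow> (\<forall>x. x \<notin> S \<longrightarrow> R' x = R x)"

text \<open>Multiplying 0/1 cells into register 7 computes their conjunction without
  branching.\<close>

primrec lookups :: "nat list list \<Rightarrow> com" where
  "lookups [] = Skip"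
| "lookups (xs # xss) = Seq (Const 6 0) (Seq (horner xs) (Seq (Load 8 6)
     (Seq (Op Mul 7 7 8) (lookups xss))))"

lemma wp_lookups:
  assumes "\<forall>xs\<in>set xss. length xs = s \<and> {0, 6, 7, 8} \<inter> set xs = {} \<and> (\<forall>x\<in>set xs. R x < n) \<and>
      M (addr n (map R xs)) = of_bool (P (R ` set xs))"
    and "R 0 = n" "R 7 \<le> 1" "n ^ s \<le> D" "1 \<le> D"
    and "\<And>R'. eqoff {6, 7, 8} R R' \<Longrightarrow>
      R' 7 = R 7 * of_bool (\<forall>xs\<in>set xss. P (R ` set xs)) \<Longrightarrow> Q R' M t"
  shows "wp D (lookups xss) Q R M t"
  using assms
proof (induction xss arbitrary: R)
  case (Cons xs xss)
  let ?a = "addr n (map R xs)"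
  let ?R = "R(6 := ?a, 8 := M ?a, 7 := R 7 * M ?a)"
  have img: "R' ` set ys = R ` set ys" and mp: "map R' ys = map R ys"
    if "eqoff {6, 7, 8} R R'" "{0, 6, 7, 8} \<inter> set ys = {}" for R' ys
  proof -
    have "R' x = R x" if "x \<in> set ys" for x
      using that \<open>eqoff _ _ _\<close> \<open>_ \<inter> set ys = _\<close>
      by (simp add: eqoff_def) metis
    then show "R' ` set ys = R ` set ys" "map R' ys = map R ys" by auto
  qed
  have "eqoff {6, 7, 8} R ?R" by (simp add: eqoff_def)
  note img' = img[OF this] and mp' = mp[OF this]
  have M: "M ?a = of_bool (P (R ` set xs))" using Cons.prems(1) by simp
  have "wp D (lookups xss) Q ?R M t"
  proof (rule Cons.IH)
    show "\<forall>xs\<in>set xss. length xs = s \<and> {0, 6, 7, 8} \<inter> set xs = {} \<and> (\<forall>x\<in>set xs. ?R x < n) \<and>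
      M (addr n (map ?R xs)) = of_bool (P (?R ` set xs))"
    proof
      fix ys assume ys: "ys \<in> set xss"
      with Cons.prems(1) have y: "length ys = s" "{0, 6, 7, 8} \<inter> set ys = {}" "\<forall>x\<in>set ys. R x < n"
        "M (addr n (map R ys)) = of_bool (P (R ` set ys))" by auto
      moreover have "?R x = R x" if "x \<in> set ys" for x using that y(2) by auto
      ultimately show "length ys = s \<and> {0, 6, 7, 8} \<inter> set ys = {} \<and> (\<forall>x\<in>set ys. ?R x < n) \<and>
        M (addr n (map ?R ys)) = of_bool (P (?R ` set ys))"
        using img'[OF y(2)] mp'[OF y(2)] by metis
    qed
    show "?R 7 \<le> 1" using Cons.prems(3) M by simp
    fix R' assume R': "eqoff {6, 7, 8} ?R R'"
      "R' 7 = ?R 7 * of_bool (\<forall>xs\<in>set xss. P (?R ` set xs))"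
    have "(\<forall>xs\<in>set xss. P (?R ` set xs)) \<longleftrightarrow> (\<forall>xs\<in>set xss. P (R ` set xs))"
      using img' Cons.prems(1) by (metis list.set_intros(2))
    with R' M show "Q R' M t"
      by (intro Cons.prems(6)) (auto simp: eqoff_def)
  qed (use Cons.prems in simp_all)
  moreover have "R 7 * M ?a \<le> D" using Cons.prems(3,5) M by simp
  ultimately have "wp D (Seq (Load 8 6) (Seq (Op Mul 7 7 8) (lookups xss))) Q (R(6 := ?a)) M t"
    by (simp add: fun_upd_twist)
  moreover have "map (R(6 := 0)) xs = map R xs" using Cons.prems(1) by auto
  ultimately show ?case
    unfolding lookups.simps wp_Seq wp_Const
    by (intro conjI wp_horner[where s = s]) (use Cons.prems in auto)
qed (simp add: eqoff_def)

text \<open>Registers are named by constants, so the earlier depths that take part in a test are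
  chosen while the program text is generated.\<close>

definition positions :: "nat \<Rightarrow> nat \<Rightarrow> nat list list" where
  "positions m j = filter (\<lambda>xs. length xs = m) (List.subseqs [0..<j])"

definition check :: "nat \<Rightarrow> nat \<Rightarrow> com" where
  "check s j = Seq (Const 7 1) (lookups (map (\<lambda>xs. map ((+) 10) (xs @ [j])) (positions (s - 1) j)))"

text \<open>Register 6 receives the start of the row of \<open>n\<close> cells that belongs to the
  last \<open>s - 1\<close> vertices and is indexed by the new vertex. The jump to the next edge may
  leave this row; the difference is then at least \<open>n\<close>, which the loop reads as
  exhaustion. With fewer than \<open>s - 1\<close> vertices chosen every vertex is a
  candidate.\<close>

definition advance :: "nat \<Rightarrow> nat \<Rightarrow> com" where
  "advance s j = (if j < s - 1 then Skip else
     Seq (Const 6 0) (Seq (horner (map ((+) 10) [j - (s - 1)..<j])) (Seq (Op Mul 6 6 0)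
     (Seq (Op Add 7 6 (10 + j)) (Seq (Op Add 7 7 5) (Seq (Load 7 7) (Op Sub (10 + j) 7 6)))))))"

text \<open>Subtraction is truncated, so the product is nonzero exactly when both a vertex and fuel
  are left. Empty fuel thus closes the loops of all depths.\<close>

definition set_flag :: "nat \<Rightarrow> com" where
  "set_flag j = Seq (Op Sub 6 0 (10 + j)) (Op Mul 9 6 3)"

text \<open>The recursion unrolls into \<open>r\<close> nested loops. They share register 9, which
  each body recomputes after the inner loops have overwritten it. Depth 0 is special because
  register 9 holds no vertex.\<close>

primrec search :: "nat \<Rightarrow> nat \<Rightarrow> nat \<Rightarrow> com" where
  "search s 0 j = Op Add 4 4 1"
| "search s (Suc r) j =
     Seq (if j = 0 then Const 10 0 else Op Add (10 + j) (9 + j) 1)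
     (Seq (advance s j) (Seq (set_flag j)
       (While 9
         (Seq (Op Sub 3 3 1) (Seq (check s j) (Seq (If 7 (search s r (Suc j)) Skip)
         (Seq (Op Add (10 + j) (10 + j) 1) (Seq (advance s j) (set_flag j)))))))))"

text \<open>
  Cell \<open>n ^ s + a\<close> of the memory points to the first edge at or after the address \<open>a\<close>. As the new vertex
  is the least significant digit of the address, one lookup skips all vertices that are
  not candidates.
\<close>

definition next_edge :: "nat \<Rightarrow> nat \<Rightarrow> nat set set \<Rightarrow> nat \<Rightarrow> nat \<Rightarrow> bool" where
  "next_edge s n E a y \<longleftrightarrow> a \<le> y \<and> y \<le> n ^ s \<and> (\<forall>b. a \<le> b \<and> b < y \<longrightarrow> input_mem s n E b = 0) \<and>
     (y < n ^ s \<longrightarrow> input_mem s n E y \<noteq> 0)"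

text \<open>The entry at \<open>a = n ^ s\<close> is included because a loop that has passed vertex
  \<open>n - 1\<close> in the last row asks for it.\<close>

definition table :: "nat \<Rightarrow> nat \<Rightarrow> nat set set \<Rightarrow> (nat \<Rightarrow> nat) \<Rightarrow> bool" where
  "table s n E M \<longleftrightarrow> (\<forall>a<n ^ s. M a = input_mem s n E a) \<and>
     (\<forall>a\<le>n ^ s. next_edge s n E a (M (n ^ s + a)))"

definition context_ok :: "nat \<Rightarrow> nat \<Rightarrow> nat list \<Rightarrow> (nat \<Rightarrow> nat) \<Rightarrow> bool" where
  "context_ok s n vs R \<longleftrightarrow> R 0 = n \<and> R 1 = 1 \<and> R 2 = 0 \<and> R 5 = n ^ s \<and>
     (\<forall>i<length vs. R (10 + i) = vs ! i)"

section \<open>Correctness and fuel consumption of the search\<close>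

lemma context_ok_eqoff:
  assumes "context_ok s n vs R" "eqoff ({3, 4, 6, 7, 8, 9} \<union> {10 + length vs..}) R R'"
  shows "context_ok s n vs R'"
  using assms by (auto simp: context_ok_def eqoff_def)

text \<open>As \<open>vs\<close> has no repetitions, choosing \<open>s - 1\<close> positions amounts
  to choosing \<open>s - 1\<close> vertices, so the lookups run over exactly the edges that
  \<open>joined\<close> asks for.\<close>

lemma wp_check:
  assumes cx: "context_ok s n (vs @ [w]) R" and vs: "distinct vs" "set vs \<subseteq> {..<n}" "w < n"
    and tab: "table s n E M" and D: "n ^ s \<le> D" "1 \<le> D" and s: "1 \<le> s"
    and Q: "\<And>R'. eqoff {6, 7, 8} R R' \<Longrightarrow> R' 7 = of_bool (joined E s vs w) \<Longrightarrow> Q R' M t"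
  shows "wp D (check s (length vs)) Q R M t"
proof -
  let ?j = "length vs"
  let ?R = "R(7 := 1)"
  let ?xss = "map (\<lambda>xs. map ((+) 10) (xs @ [?j])) (positions (s - 1) ?j)"
  have Rj: "R (10 + ?j) = w" and Ri: "\<And>i. i < ?j \<Longrightarrow> R (10 + i) = vs ! i"
    using cx unfolding context_ok_def by (force simp: nth_append)+
  have pos: "length xs = s - 1" "set xs \<subseteq> {..<?j}" "distinct xs" if "xs \<in> set (positions (s - 1) ?j)" for xs
  proof -
    have "xs \<in> set (List.subseqs [0..<?j])" "length xs = s - 1"
      using that by (auto simp: positions_def)
    moreover from this(1) have "set xs \<in> set ` set (List.subseqs [0..<?j])" by (rule imageI)
    then have "set xs \<subseteq> {..<?j}"
      unfolding subseqs_powset by (simp add: atLeast0LessThan)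
    ultimately show "length xs = s - 1" "set xs \<subseteq> {..<?j}" "distinct xs"
      using subseqs_distinctD[of xs "[0..<?j]"] by simp_all
  qed
  have img: "?R ` set (map ((+) 10) (xs @ [?j])) = insert w ((!) vs ` set xs)"
    if "xs \<in> set (positions (s - 1) ?j)" for xs
  proof -
    have "?R ` (+) 10 ` set xs = (!) vs ` set xs"
      unfolding image_image using pos[OF that] Ri by (intro image_cong) auto
    moreover have "?R (10 + ?j) = w" using Rj by simp
    ultimately show ?thesis
      by (simp only: set_map set_append list.set image_Un image_insert image_empty) blast
  qed
  have "(\<forall>xs\<in>set ?xss. ?R ` set xs \<in> E) \<longleftrightarrow> joined E s vs w"
  proof -
    have "(\<lambda>xs. (!) vs ` set xs) ` set (positions (s - 1) ?j) = nsets (set vs) (s - 1)"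
    proof (intro equalityI subsetI)
      fix U assume "U \<in> (\<lambda>xs. (!) vs ` set xs) ` set (positions (s - 1) ?j)"
      then obtain xs where xs: "U = (!) vs ` set xs" "xs \<in> set (positions (s - 1) ?j)" by blast
      then have "card U = card (set xs)"
        using pos[OF xs(2)] vs(1) by (auto intro!: card_image inj_on_subset[OF inj_on_nth[of vs "{..<?j}"]])
      with pos[OF xs(2)] xs show "U \<in> nsets (set vs) (s - 1)"
        by (auto simp: nsets_def distinct_card)
    next
      fix U assume U: "U \<in> nsets (set vs) (s - 1)"
      define I where "I = {i. i < ?j \<and> vs ! i \<in> U}"
      have "I \<in> set ` set (List.subseqs [0..<?j])"
        unfolding subseqs_powset by (auto simp: I_def)
      then obtain xs where xs: "xs \<in> set (List.subseqs [0..<?j])" "I = set xs" by blast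
      have UI: "U = (!) vs ` I" using U by (auto simp: I_def nsets_def in_set_conv_nth subset_iff image_iff)
      have "card U = card I"
        unfolding UI by (rule card_image) (use vs in \<open>auto simp: I_def intro: inj_on_nth\<close>)
      moreover have "distinct xs" using xs subseqs_distinctD by force
      ultimately have "length xs = s - 1"
        using U xs by (simp add: distinct_card nsets_def)
      with xs UI show "U \<in> (\<lambda>xs. (!) vs ` set xs) ` set (positions (s - 1) ?j)"
        by (auto simp: positions_def)
    qed
    then have "joined E s vs w \<longleftrightarrow> (\<forall>xs\<in>set (positions (s - 1) ?j). insert w ((!) vs ` set xs) \<in> E)"
      unfolding joined_def by (metis (no_types, lifting) image_iff)
    moreover have "(\<forall>xs\<in>set ?xss. ?R ` set xs \<in> E) \<longleftrightarrow>
        (\<forall>xs\<in>set (positions (s - 1) ?j). ?R ` set (map ((+) 10) (xs @ [?j])) \<in> E)"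
      unfolding set_map[of "\<lambda>xs. map ((+) 10) (xs @ [?j])"] by blast
    moreover have "\<dots> \<longleftrightarrow> (\<forall>xs\<in>set (positions (s - 1) ?j). insert w ((!) vs ` set xs) \<in> E)"
      by (intro ball_cong refl) (simp only: img)
    ultimately show ?thesis by blast
  qed
  moreover have "wp D (lookups ?xss) Q ?R M t"
  proof (rule wp_lookups[where P = "\<lambda>X. X \<in> E" and n = n and s = s])
    show "\<forall>xs\<in>set ?xss. length xs = s \<and> {0, 6, 7, 8} \<inter> set xs = {} \<and> (\<forall>x\<in>set xs. ?R x < n) \<and>
      M (addr n (map ?R xs)) = of_bool (?R ` set xs \<in> E)"
    proof
      fix ys assume "ys \<in> set ?xss"
      then obtain xs where xs: "ys = map ((+) 10) (xs @ [?j])" "xs \<in> set (positions (s - 1) ?j)" by auto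
      have len: "length ys = s" using pos[OF xs(2)] xs s by simp
      have lt: "\<forall>x\<in>set ys. ?R x < n"
        using pos[OF xs(2)] xs vs Ri Rj by (auto simp: subset_iff)
      then have set: "set (map ?R ys) \<subseteq> {..<n}" by auto
      have "M (addr n (map ?R ys)) = input_mem s n E (addr n (map ?R ys))"
        using tab addr_less[OF set] len by (simp add: table_def)
      also have "\<dots> = of_bool (?R ` set ys \<in> E)"
        using input_mem_addr[OF _ set, of s E] len by simp
      finally show "length ys = s \<and> {0, 6, 7, 8} \<inter> set ys = {} \<and> (\<forall>x\<in>set ys. ?R x < n) \<and>
        M (addr n (map ?R ys)) = of_bool (?R ` set ys \<in> E)" using len lt xs(1) by auto
    qed
    fix R' assume "eqoff {6, 7, 8} ?R R'" "R' 7 = ?R 7 * of_bool (\<forall>xs\<in>set ?xss. ?R ` set xs \<in> E)"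
    with calculation show "Q R' M t" by (intro Q) (simp_all add: eqoff_def)
  qed (use cx D in \<open>simp_all add: context_ok_def\<close>)
  ultimately show ?thesis using D by (simp add: check_def)
qed

lemma wp_advance:
  assumes cx: "context_ok s n vs R" and vs: "set vs \<subseteq> {..<n}" and w: "R (10 + length vs) \<le> n"
    and tab: "table s n E M" and D: "2 * n ^ s \<le> D" and s: "2 \<le> s"
    and Q: "\<And>R' w'. eqoff {6, 7, 10 + length vs} R R' \<Longrightarrow> R' (10 + length vs) = w' \<Longrightarrow>
       R (10 + length vs) \<le> w' \<Longrightarrow> (w' < n \<Longrightarrow> candidate E s vs w') \<Longrightarrow>
       (\<And>x. R (10 + length vs) \<le> x \<Longrightarrow> x < w' \<Longrightarrow> x < n \<Longrightarrow> \<not> candidate E s vs x) \<Longrightarrow> Q R' M t"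
  shows "wp D (advance s (length vs)) Q R M t"
proof (cases "length vs < s - 1")
  case True
  then show ?thesis
    by (simp add: advance_def) (rule Q, auto simp: eqoff_def candidate_def)
next
  case False
  let ?j = "length vs"
  let ?us = "drop (?j - (s - 1)) vs"
  let ?w = "R (10 + ?j)"
  let ?b = "addr n ?us * n"
  let ?y = "M (n ^ s + (?b + ?w))"
  have us: "set ?us \<subseteq> {..<n}" "length ?us = s - 1"
    using vs set_drop_subset[of "?j - (s - 1)" vs] False by auto
  have map: "map (R(6 := 0)) (map ((+) 10) [?j - (s - 1)..<?j]) = ?us"
    using cx by (auto simp: context_ok_def intro!: nth_equalityI)
  have lt: "R (10 + i) < n" if "i < ?j" for i
    using cx vs that by (metis context_ok_def lessThan_iff nth_mem subsetD)
  have "n \<noteq> 0" using us s by (cases ?us) auto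
  have "addr n ?us + 1 \<le> n ^ (s - 1)" using addr_less[OF us(1)] us(2) by simp
  then have "(addr n ?us + 1) * n \<le> n ^ (s - 1) * n" by (rule mult_le_mono1)
  also have "\<dots> = n ^ s" using s by (metis Suc_diff_1 order_less_le_trans pos2 power_Suc2)
  \<comment> \<open>The row lies inside the tensor, so even position \<open>n\<close>, one past its
    end, has a table entry.\<close>
  finally have b: "?b + n \<le> n ^ s" by simp
  with w tab have nxt: "next_edge s n E (?b + ?w) ?y" by (simp add: table_def)
  have mem: "input_mem s n E (?b + x) = of_bool (candidate E s vs x)" if "x < n" for x
  proof -
    have "input_mem s n E (addr n (?us @ [x])) = of_bool (set (?us @ [x]) \<in> E)"
      by (rule input_mem_addr) (use us s that in auto)
    with False show ?thesis by (simp add: candidate_def)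
  qed
  have "wp D (Seq (Op Mul 6 6 0) (Seq (Op Add 7 6 (10 + ?j)) (Seq (Op Add 7 7 5)
      (Seq (Load 7 7) (Op Sub (10 + ?j) 7 6))))) Q (R(6 := addr n ?us)) M t"
  proof -
    have R: "R 0 = n" "R 5 = n ^ s" using cx by (simp_all add: context_ok_def)
    have "Q (R(6 := ?b, 7 := ?y, 10 + ?j := ?y - ?b)) M t"
    proof (rule Q)
      have "?b + ?w \<le> ?y" using nxt by (simp add: next_edge_def)
      then show "?w \<le> ?y - ?b" by simp
      \<comment> \<open>A difference below \<open>n\<close> means that the jump ended inside the
        row, hence at an edge and not at the sentinel \<open>n ^ s\<close>.\<close>
      show "candidate E s vs (?y - ?b)" if "?y - ?b < n"
      proof -
        have "?y = ?b + (?y - ?b)" using nxt by (simp add: next_edge_def)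
        moreover have "?y < n ^ s" using calculation that b by linarith
        ultimately have "input_mem s n E (?b + (?y - ?b)) \<noteq> 0" using nxt by (simp add: next_edge_def)
        then show ?thesis using mem[OF that] by auto
      qed
      show "\<not> candidate E s vs x" if "?w \<le> x" "x < ?y - ?b" "x < n" for x
      proof -
        have "input_mem s n E (?b + x) = 0" using nxt that by (simp add: next_edge_def)
        then show ?thesis using mem[OF that(3)] by simp
      qed
    qed (auto simp: eqoff_def)
    moreover have "?y \<le> n ^ s" using nxt by (simp add: next_edge_def)
    then have "?b \<le> D" "?b + ?w \<le> D" "?b + ?w + n ^ s \<le> D" "?y - ?b \<le> D" using b w D by linarith+
    ultimately show ?thesis by (simp add: R fun_upd_twist add.commute add.left_commute)
  qed
  note tail = this
  have "wp D (horner (map ((+) 10) [?j - (s - 1)..<?j])) (wp D (Seq (Op Mul 6 6 0)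
      (Seq (Op Add 7 6 (10 + ?j)) (Seq (Op Add 7 7 5)
      (Seq (Load 7 7) (Op Sub (10 + ?j) 7 6))))) Q) (R(6 := 0)) M t"
  proof (rule wp_horner[where s = s])
    have R0: "(R(6 := 0)) 0 = n" using cx by (simp add: context_ok_def)
    show "\<forall>x\<in>set (map ((+) 10) [?j - (s - 1)..<?j]). (R(6 := 0)) x < (R(6 := 0)) 0"
    proof (intro ballI)
      fix x assume "x \<in> set (map ((+) 10) [?j - (s - 1)..<?j])"
      then have "x - 10 < ?j" "10 + (x - 10) = x" by auto
      then show "(R(6 := 0)) x < (R(6 := 0)) 0" using lt[of "x - 10"] R0 by simp
    qed
    show "(R(6 := 0)) 0 ^ s \<le> D" unfolding R0 using D by simp
    show "wp D (Seq (Op Mul 6 6 0) (Seq (Op Add 7 6 (10 + ?j)) (Seq (Op Add 7 7 5)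
      (Seq (Load 7 7) (Op Sub (10 + ?j) 7 6))))) Q ((R(6 := 0))
      (6 := addr ((R(6 := 0)) 0) (map (R(6 := 0)) (map ((+) 10) [?j - (s - 1)..<?j])))) M t"
      unfolding map R0 fun_upd_upd by (rule tail)
  qed (use us in auto)
  with False show ?thesis
    by (simp only: advance_def if_False wp_Seq wp_Const le0 simp_thms)
qed

lemma wp_set_flag:
  assumes "R 0 \<le> D" "R 0 * R 3 \<le> D" "Q (R(6 := R 0 - R (10 + j), 9 := (R 0 - R (10 + j)) * R 3)) M t"
  shows "wp D (set_flag j) Q R M t"
proof -
  have "(R 0 - R (10 + j)) * R 3 \<le> R 0 * R 3" by (rule mult_le_mono1) simp
  also note assms(2)
  finally have "(R 0 - R (10 + j)) * R 3 \<le> D" .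
  moreover have "R 0 - R (10 + j) \<le> D" using assms(1) by linarith
  ultimately show ?thesis using assms(3) by (simp add: set_flag_def)
qed

text \<open>Fuel (register 3) is spent once per candidate. It only has to be sufficient for the
  correctness of the count in register 4, while the number of loop iterations is always bounded
  by the fuel spent.\<close>

lemma wp_search:
  fixes n s k D F :: nat and E :: "nat set set" and d :: "nat \<Rightarrow> nat"
  defines "ext \<equiv> extensions n E s"
  assumes s: "2 \<le> s" and D: "2 * n ^ s \<le> D" "n * F \<le> D" "n \<le> D" "F + 1 \<le> D"
    and tab: "table s n E M"
    and d: "\<And>vs. ordered_clique n E s vs \<Longrightarrow> length vs < k \<Longrightarrow> card (candidates n E s vs) \<le> d (length vs)"
    and vs: "ordered_clique n E s vs" "length vs + r = k"
    and cx: "context_ok s n vs R" and F: "R 4 + R 3 \<le> F"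
    and Q: "\<And>R' u. context_ok s n vs R' \<Longrightarrow> R' 3 \<le> R 3 \<Longrightarrow>
      (R' 3 > 0 \<Longrightarrow> R' 4 = R 4 + card (ext (set vs) k)) \<Longrightarrow>
      R 3 \<le> R' 3 + (\<Sum>m=length vs..<k. card (ext (set vs) m) * d m) \<Longrightarrow>
      R' 4 + R' 3 \<le> R 4 + R 3 + of_bool (r = 0) \<Longrightarrow> u + R' 3 \<le> t + R 3 \<Longrightarrow> Q R' M u"
  shows "wp D (search s r (length vs)) Q R M t"
  using vs cx F Q
proof (induction r arbitrary: vs R Q t)
  case 0
  have "ext (set vs) k = {set vs}"
    using extensions_length[OF 0(1)] 0(2) by (simp add: ext_def)
  moreover have "R 1 = 1" using 0(3) by (simp add: context_ok_def)
  moreover have "context_ok s n vs (R(4 := Suc (R 4)))"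
    by (rule context_ok_eqoff[OF 0(3)]) (simp add: eqoff_def)
  ultimately show ?case
    using 0(4) D by (auto intro!: 0(5) simp: 0(2))
next
  case (Suc r)
  let ?j = "length vs"
  let ?C = "candidates n E s vs"
  let ?C' = "\<lambda>w. {x \<in> ?C. x < w}"
  \<comment> \<open>\<open>g x\<close> is what candidate \<open>x\<close> adds to the count.
    \<open>h x\<close> bounds its fuel: one unit for itself and, if it is joined, a bound for the
    candidates tested in its subtree.\<close>
  define g where "g x = (if joined E s vs x then card (ext (insert x (set vs)) k) else 0)" for x
  define h where "h x = Suc (if joined E s vs x
      then \<Sum>m=Suc ?j..<k. card (ext (insert x (set vs)) m) * d m else 0)" for x
  define a0 f0 where "a0 = R 4" and "f0 = R 3"
  have D1: "n ^ s \<le> D" "1 \<le> D" using D by simp_all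
  have j: "?j < k" using Suc.prems(2) by simp
  have setvs: "set vs \<subseteq> {..<n}" using Suc.prems(1) by (simp add: ordered_clique_def)
  have sum_g: "card (ext (set vs) k) = (\<Sum>x\<in>?C. g x)"
    unfolding g_def ext_def by (rule card_extensions_sum) (use Suc.prems s in auto)
  \<comment> \<open>The units for the candidates themselves fit into the summand
    \<open>m = length vs\<close>, where \<open>vs\<close> is its only extension. For larger
    \<open>m\<close>, exchanging the sums collects the extensions through the candidates into those
    of \<open>vs\<close>.\<close>
  have sum_h: "(\<Sum>x\<in>?C. h x) \<le> (\<Sum>m=?j..<k. card (ext (set vs) m) * d m)"
  proof -
    have "(\<Sum>x\<in>?C. h x) = card ?C + (\<Sum>x\<in>?C. \<Sum>m=Suc ?j..<k.
        (if joined E s vs x then card (ext (insert x (set vs)) m) else 0) * d m)"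
    proof -
      have "(\<Sum>x\<in>?C. h x) = (\<Sum>x\<in>?C. 1 + (\<Sum>m=Suc ?j..<k.
        (if joined E s vs x then card (ext (insert x (set vs)) m) else 0) * d m))"
        by (rule sum.cong) (simp_all add: h_def)
      then show ?thesis by (simp only: sum.distrib card_eq_sum)
    qed
    also have "(\<Sum>x\<in>?C. \<Sum>m=Suc ?j..<k.
        (if joined E s vs x then card (ext (insert x (set vs)) m) else 0) * d m) =
        (\<Sum>m=Suc ?j..<k. card (ext (set vs) m) * d m)"
      unfolding ext_def sum.swap[of _ _ ?C] sum_distrib_right[symmetric]
      by (rule sum.cong[OF refl], rule arg_cong2[where f = "(*)"])
        (use card_extensions_sum[OF Suc.prems(1)] s in auto)
    also have "card ?C \<le> card (ext (set vs) ?j) * d ?j"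
      using d[OF Suc.prems(1) j] extensions_length[OF Suc.prems(1)] by (simp add: ext_def)
    finally show ?thesis using j by (simp add: sum.atLeast_Suc_lessThan)
  qed
  define G H where "G b = (\<Sum>x\<in>?C' b. g x)" and "H b = (\<Sum>x\<in>?C' b. h x)" for b
  \<comment> \<open>The count is exact only while fuel remains, but the spending bound through
    \<open>H\<close> survives exhaustion. Registers 4 and 3 together cannot grow, as each counted
    clique has been paid for; this keeps the count small even on hypergraphs with many cliques. The
    last conjunct charges every iteration to the fuel.\<close>
  define I where "I R' M' u \<longleftrightarrow> M' = M \<and> context_ok s n vs R' \<and> first_vertex vs \<le> R' (10 + ?j) \<and>
     (R' (10 + ?j) < n \<longrightarrow> R' (10 + ?j) \<in> ?C) \<and> R' 9 = (n - R' (10 + ?j)) * R' 3 \<and> R' 3 \<le> f0 \<and>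
     (R' 3 > 0 \<longrightarrow> R' 4 = a0 + G (R' (10 + ?j))) \<and>
     f0 \<le> R' 3 + H (R' (10 + ?j)) \<and> R' 4 + R' 3 \<le> a0 + f0 \<and> u + R' 3 \<le> t + f0"
    for R' M' :: "nat \<Rightarrow> nat" and u
  \<comment> \<open>Entering the loop and completing an iteration both end by moving to the first candidate
    not below \<open>w\<close>.\<close>
  have seek: "wp D (advance s ?j) (wp D (set_flag ?j) (\<lambda>R2 M2 u. I R2 M2 u \<and> R2 3 = R1 3)) R1 M u"
    if "context_ok s n vs R1" and w: "R1 (10 + ?j) \<le> n" "first_vertex vs \<le> R1 (10 + ?j)"
      and "R1 3 \<le> f0" "R1 3 > 0 \<Longrightarrow> R1 4 = a0 + G (R1 (10 + ?j))"
      and "f0 \<le> R1 3 + H (R1 (10 + ?j))"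
      and "R1 4 + R1 3 \<le> a0 + f0" "u + R1 3 \<le> t + f0" for R1 u
  proof (rule wp_advance[OF that(1) setvs w(1) tab D(1) s])
    fix R2 w' assume eq: "eqoff {6, 7, 10 + ?j} R1 R2" and w': "R2 (10 + ?j) = w'"
      "R1 (10 + ?j) \<le> w'" "w' < n \<Longrightarrow> candidate E s vs w'"
      "\<And>x. R1 (10 + ?j) \<le> x \<Longrightarrow> x < w' \<Longrightarrow> x < n \<Longrightarrow> \<not> candidate E s vs x"
    let ?R = "R2(6 := R2 0 - R2 (10 + ?j), 9 := (R2 0 - R2 (10 + ?j)) * R2 3)"
    have cx: "context_ok s n vs ?R"
      by (rule context_ok_eqoff[OF that(1)]) (use eq in \<open>auto simp: eqoff_def\<close>)
    have R2: "R2 0 = n" "R2 3 = R1 3" "R2 4 = R1 4"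
      using eq that(1) by (auto simp: eqoff_def context_ok_def)
    have C: "?C' (R1 (10 + ?j)) = ?C' w'"
    proof (intro equalityI subsetI)
      fix x assume "x \<in> ?C' w'"
      then show "x \<in> ?C' (R1 (10 + ?j))" using w'(4)[of x] by (force simp: candidates_def)
    qed (use w'(2) in auto)
    then have "G (R1 (10 + ?j)) = G w'" "H (R1 (10 + ?j)) = H w'" by (simp_all add: G_def H_def)
    then have "I ?R M u"
      unfolding I_def using that w' R2 cx by (auto simp: candidates_def)
    moreover have "n * R1 3 \<le> D"
    proof -
      have "R1 3 \<le> F" using that(7) Suc.prems(4) by (simp add: a0_def f0_def)
      from mult_le_mono2[OF this, of n] D(2) show ?thesis by linarith
    qed
    ultimately show "wp D (set_flag ?j) (\<lambda>R2 M2 u. I R2 M2 u \<and> R2 3 = R1 3) R2 M u"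
      using R2 D(3) by (intro wp_set_flag) simp_all
  qed
  have body: "wp D (Seq (Op Sub 3 3 1) (Seq (check s ?j) (Seq (If 7 (search s r (Suc ?j)) Skip)
         (Seq (Op Add (10 + ?j) (10 + ?j) 1) (Seq (advance s ?j) (set_flag ?j))))))
       (\<lambda>R2 M2 u. I R2 M2 u \<and> R2 3 < R1 3) R1 M1 (Suc u)"
    if "I R1 M1 u" "R1 9 \<noteq> 0" for R1 M1 u
  proof -
    note I = that(1)[unfolded I_def]
    define w where "w = R1 (10 + ?j)"
    have M1: "M1 = M" using I by blast
    have w: "w < n" "R1 3 > 0" "w \<in> ?C" using I that(2) by (auto simp: w_def)
    have "?C' (Suc w) = insert w (?C' w)" using w by auto
    then have GH: "G (Suc w) = G w + g w" "H (Suc w) = H w + h w" by (simp_all add: G_def H_def)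
    have tail: "wp D (Op Add (10 + ?j) (10 + ?j) 1) (wp D (advance s ?j) (wp D (set_flag ?j)
         (\<lambda>R2 M2 u. I R2 M2 u \<and> R2 3 < R1 3))) R2 M u2"
      if "context_ok s n (vs @ [w]) R2" "R2 3 < R1 3"
        "R2 3 > 0 \<Longrightarrow> R2 4 = R1 4 + g w" "R1 3 \<le> R2 3 + h w"
        "R2 4 + R2 3 \<le> R1 4 + R1 3" "u2 + R2 3 \<le> u + R1 3" for R2 u2
    proof -
      let ?R = "R2(10 + ?j := Suc w)"
      have one: "R2 1 = 1" "R2 (10 + ?j) = w" using that(1) by (auto simp: context_ok_def nth_append)
      have cx: "context_ok s n vs ?R" using that(1) by (auto simp: context_ok_def nth_append)
      have "wp D (advance s ?j) (wp D (set_flag ?j) (\<lambda>R2 M2 u. I R2 M2 u \<and> R2 3 = ?R 3)) ?R M u2"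
        by (rule seek[OF cx])
          (use w I that GH in \<open>auto simp: w_def\<close>)
      then have "wp D (advance s ?j) (wp D (set_flag ?j) (\<lambda>R2 M2 u. I R2 M2 u \<and> R2 3 < R1 3)) ?R M u2"
        by (elim wp_mono) (use that(2) in auto)
      with one w D show ?thesis by simp
    qed
    let ?R = "R1(3 := R1 3 - 1)"
    have cx: "context_ok s n (vs @ [w]) ?R"
      using I by (auto simp: context_ok_def nth_append w_def less_Suc_eq)
    have "wp D (check s ?j) (wp D (Seq (If 7 (search s r (Suc ?j)) Skip)
         (Seq (Op Add (10 + ?j) (10 + ?j) 1) (Seq (advance s ?j) (set_flag ?j))))
       (\<lambda>R2 M2 u. I R2 M2 u \<and> R2 3 < R1 3)) ?R M (Suc u)"
    proof (rule wp_check[OF cx ordered_clique_distinct[OF Suc.prems(1)] setvs w(1) tab D1])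
      show "1 \<le> s" using s by simp
      fix R2 assume eq: "eqoff {6, 7, 8} ?R R2" and R7: "R2 7 = of_bool (joined E s vs w)"
      have R2: "R2 3 = R1 3 - 1" "R2 4 = R1 4" using eq by (auto simp: eqoff_def)
      have cx2: "context_ok s n (vs @ [w]) R2"
        by (rule context_ok_eqoff[OF cx]) (use eq in \<open>auto simp: eqoff_def\<close>)
      show "wp D (Seq (If 7 (search s r (Suc ?j)) Skip)
         (Seq (Op Add (10 + ?j) (10 + ?j) 1) (Seq (advance s ?j) (set_flag ?j))))
        (\<lambda>R2 M2 u. I R2 M2 u \<and> R2 3 < R1 3) R2 M (Suc u)"
      proof (cases "joined E s vs w")
        case False
        then have "g w = 0" "h w = 1" by (simp_all add: g_def h_def)
        with False R7 show ?thesis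
          using tail[OF cx2, of "Suc u"] R2 w by simp
      next
        case True
        have oc: "ordered_clique n E s (vs @ [w])"
          using ordered_clique_snoc[OF Suc.prems(1), of w] True w s by (auto simp: candidates_def)
        have "wp D (search s r (length (vs @ [w]))) (wp D (Op Add (10 + ?j) (10 + ?j) 1)
            (wp D (advance s ?j) (wp D (set_flag ?j) (\<lambda>R2 M2 u. I R2 M2 u \<and> R2 3 < R1 3)))) R2 M (Suc u)"
        proof (rule Suc.IH[OF oc _ cx2])
          show "length (vs @ [w]) + r = k" using Suc.prems(2) by simp
          have "R1 4 + R1 3 \<le> a0 + f0" using I by blast
          then show "R2 4 + R2 3 \<le> F" using Suc.prems(4) R2 by (simp add: a0_def f0_def)
          fix R3 v assume R3: "context_ok s n (vs @ [w]) R3" "R3 3 \<le> R2 3"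
            "R3 3 > 0 \<Longrightarrow> R3 4 = R2 4 + card (ext (set (vs @ [w])) k)"
            "R2 3 \<le> R3 3 + (\<Sum>m=length (vs @ [w])..<k. card (ext (set (vs @ [w])) m) * d m)"
            "R3 4 + R3 3 \<le> R2 4 + R2 3 + of_bool (r = 0)" "v + R3 3 \<le> Suc u + R2 3"
          \<comment> \<open>A leaf counts one clique without spending; the unit spent on this
            candidate before the call makes up for it.\<close>
          have "of_bool (r = 0) \<le> (1::nat)" by simp
          then have "R3 4 + R3 3 \<le> R1 4 + R1 3" using R3(5) R2 w by linarith
          then show "wp D (Op Add (10 + ?j) (10 + ?j) 1) (wp D (advance s ?j) (wp D (set_flag ?j)
              (\<lambda>R2 M2 u. I R2 M2 u \<and> R2 3 < R1 3))) R3 M v"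
            using tail[OF R3(1), of v] R3(2,3,4,6) R2 w True by (simp add: g_def h_def)
        qed
        with True R7 show ?thesis by simp
      qed
    qed
    moreover have "R1 1 = 1" using I by (simp add: context_ok_def)
    moreover have "R1 3 - 1 \<le> D"
    proof -
      have "R1 3 \<le> f0" using I by blast
      then show ?thesis using Suc.prems(4) D(4) by (simp add: f0_def)
    qed
    ultimately show ?thesis by (simp add: M1)
  qed
  have "wp D (if ?j = 0 then Const 10 0 else Op Add (10 + ?j) (9 + ?j) 1)
    (wp D (advance s ?j) (wp D (set_flag ?j) I)) R M t"
  proof -
    let ?R = "R(10 + ?j := first_vertex vs)"
    have fv: "first_vertex vs \<le> n"
      using setvs by (cases vs rule: rev_cases) (auto simp: first_vertex_def)
    have cx: "context_ok s n vs ?R" using Suc.prems(3) by (simp add: context_ok_def)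
    have "?C' (first_vertex vs) = {}" by (auto simp: candidates_def)
    then have GH: "G (first_vertex vs) = 0" "H (first_vertex vs) = 0"
      unfolding G_def H_def by (simp_all only: sum.empty)
    have "wp D (advance s ?j) (wp D (set_flag ?j) (\<lambda>R2 M2 u. I R2 M2 u \<and> R2 3 = ?R 3)) ?R M t"
      by (rule seek[OF cx]) (use fv GH in \<open>auto simp: a0_def f0_def\<close>)
    then have "wp D (advance s ?j) (wp D (set_flag ?j) I) ?R M t"
      by (elim wp_mono) auto
    moreover have "R (9 + ?j) = last vs" "R 1 = 1" if "vs \<noteq> []"
    proof -
      have "9 + ?j = 10 + (?j - 1)" using that by (cases vs) auto
      moreover have "R (10 + (?j - 1)) = vs ! (?j - 1)"
        using Suc.prems(3) that by (simp add: context_ok_def)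
      ultimately have "R (9 + ?j) = vs ! (?j - 1)" by (simp only:)
      then show "R (9 + ?j) = last vs" using that by (simp add: last_conv_nth)
      show "R 1 = 1" using Suc.prems(3) by (simp add: context_ok_def)
    qed
    ultimately show ?thesis
      using fv D by (cases "vs = []") (auto simp: first_vertex_def)
  qed
  then have "wp D (if ?j = 0 then Const 10 0 else Op Add (10 + ?j) (9 + ?j) 1)
    (wp D (advance s ?j) (wp D (set_flag ?j) (wp D (While 9
         (Seq (Op Sub 3 3 1) (Seq (check s ?j) (Seq (If 7 (search s r (Suc ?j)) Skip)
         (Seq (Op Add (10 + ?j) (10 + ?j) 1) (Seq (advance s ?j) (set_flag ?j))))))) Q))) R M t"
  proof (elim wp_mono)
    fix R1 M1 u assume "I R1 M1 u"
    then have "wp D (While 9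
         (Seq (Op Sub 3 3 1) (Seq (check s ?j) (Seq (If 7 (search s r (Suc ?j)) Skip)
         (Seq (Op Add (10 + ?j) (10 + ?j) 1) (Seq (advance s ?j) (set_flag ?j)))))))
        (\<lambda>R M u. I R M u \<and> R 9 = 0) R1 M1 u"
      by (rule wp_While[where I = I and \<mu> = "\<lambda>R. R 3"]) (rule body)
    then show "wp D (While 9
         (Seq (Op Sub 3 3 1) (Seq (check s ?j) (Seq (If 7 (search s r (Suc ?j)) Skip)
         (Seq (Op Add (10 + ?j) (10 + ?j) 1) (Seq (advance s ?j) (set_flag ?j))))))) Q R1 M1 u"
    proof (elim wp_mono)
      fix R2 M2 v assume R2: "I R2 M2 v \<and> R2 9 = 0"
      note I = conjunct1[OF R2, unfolded I_def]
      have "H (R2 (10 + ?j)) \<le> (\<Sum>x\<in>?C. h x)"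
        unfolding H_def by (rule sum_mono2) auto
      \<comment> \<open>If the flag is 0 although fuel remains, the vertex register has reached
        \<open>n\<close>, so every candidate has been processed.\<close>
      moreover have "G (R2 (10 + ?j)) = (\<Sum>x\<in>?C. g x)" if "R2 3 > 0"
      proof -
        have "?C' (R2 (10 + ?j)) = ?C" using I R2 that by (auto simp: candidates_def)
        then show ?thesis by (simp only: G_def)
      qed
      ultimately have "Q R2 M v"
        using I sum_g sum_h by (intro Suc.prems(5)) (auto simp: a0_def f0_def)
      with I show "Q R2 M2 v" by simp
    qed
  qed
  then show ?case unfolding search.simps wp_Seq .
qed

subsection \<open>The complete program\<close>

text \<open>Linear search is cheap enough here, since it makes only \<open>fuel p q n\<close>
  iterations. Register 8 is the truncated difference \<open>n ^ p + 1 - b ^ q\<close>, nonzero while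
  \<open>b ^ q \<le> n ^ p\<close>; it starts as 1 to force the first round.\<close>

definition fuel_com :: "nat \<Rightarrow> nat \<Rightarrow> com" where
  "fuel_com p q =
     Seq (Const 6 1) (Seq (mulpow 6 0 p) (Seq (Op Add 6 6 1) (Seq (Const 8 1)
     (While 8 (Seq (Op Add 3 3 1) (Seq (Const 7 1) (Seq (mulpow 7 3 q) (Op Sub 8 6 7))))))))"

text \<open>A backward pass in which register 6 holds the nearest edge seen so far, initially the
  sentinel \<open>n ^ s\<close>. Adding register 2, which is zero, serves as a register
  move.\<close>

definition table_com :: com where
  "table_com =
     Seq (Op Add 6 5 2) (Seq (Op Add 7 5 2) (Seq (Op Add 8 5 5) (Seq (Store 6 8)
     (While 7 (Seq (Op Sub 7 7 1) (Seq (Load 8 7) (Seq (If 8 (Op Add 6 7 2) Skip)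
       (Seq (Op Add 8 5 7) (Store 6 8)))))))))"

definition clique_count :: "nat \<Rightarrow> nat \<Rightarrow> nat \<Rightarrow> nat \<Rightarrow> com" where
  "clique_count p q s k =
     Seq (Const 1 1) (Seq (Const 5 1) (Seq (mulpow 5 0 s) (Seq (fuel_com p q)
     (Seq table_com (Seq (search s k 0) (Op Add 0 4 2))))))"

text \<open>For \<open>1 \<le> q\<close> and \<open>1 \<le> n\<close> this is the least integer
  above \<open>n powr (p / q)\<close>, phrased without roots so that the program can compute it
  exactly.\<close>

definition fuel :: "nat \<Rightarrow> nat \<Rightarrow> nat \<Rightarrow> nat" where
  "fuel p q n = (LEAST b. n ^ p < b ^ q)"

lemma fuel_eqI:
  assumes "n ^ p < b ^ q" "(b - 1) ^ q \<le> n ^ p"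
  shows "fuel p q n = b"
  unfolding fuel_def
proof (rule Least_equality)
  fix y assume y: "n ^ p < y ^ q"
  show "b \<le> y"
  proof (rule ccontr)
    assume "\<not> b \<le> y"
    then have "y ^ q \<le> (b - 1) ^ q" by (intro power_mono) auto
    with y assms(2) show False by simp
  qed
qed (rule assms)

lemma fuel_gt: "1 \<le> q \<Longrightarrow> n ^ p < fuel p q n ^ q"
  unfolding fuel_def
  by (rule LeastI[of _ "Suc (n ^ p)"]) (rule less_le_trans[OF lessI], rule self_le_power, auto)

lemma fuel_pos:
  assumes "1 \<le> q"
  shows "0 < fuel p q n"
proof (rule ccontr)
  assume "\<not> ?thesis"
  with fuel_gt[OF assms, of n p] assms show False by (simp add: power_0_left)
qed

lemma fuel_pred_le: "1 \<le> q \<Longrightarrow> (fuel p q n - 1) ^ q \<le> n ^ p"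
  using not_less_Least[of "fuel p q n - 1" "\<lambda>b. n ^ p < b ^ q"] fuel_pos[of q p n]
  by (simp add: fuel_def[symmetric])

lemma fuel_le:
  assumes "1 \<le> q"
  shows "fuel p q n \<le> n ^ p + 1"
proof (cases "fuel p q n - 1 = 0")
  case False
  then have "fuel p q n - 1 \<le> (fuel p q n - 1) ^ q" using assms by (intro self_le_power) auto
  with fuel_pred_le[OF assms, of p n] show ?thesis by linarith
qed simp

text \<open>The summands cover the table addresses, the vertices, and both the powers
  \<open>b ^ q\<close> tried in the fuel loop and the products formed by
  \<open>set_flag\<close>.\<close>

definition number_bound :: "nat \<Rightarrow> nat \<Rightarrow> nat \<Rightarrow> nat \<Rightarrow> nat" where
  "number_bound p q s n = 2 * n ^ s + n + (n + 1) * (n ^ p + 2) ^ q"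

lemma number_bound:
  assumes "1 \<le> q"
  shows "2 * n ^ s \<le> number_bound p q s n" "n \<le> number_bound p q s n"
    "n ^ p + 2 \<le> number_bound p q s n" "b \<le> n ^ p + 1 \<Longrightarrow> b ^ q \<le> number_bound p q s n"
    "n * fuel p q n \<le> number_bound p q s n"
proof -
  have X: "(n + 1) * (n ^ p + 2) ^ q \<le> number_bound p q s n"
    and Y: "n ^ p + 2 \<le> (n ^ p + 2) ^ q"
    using assms by (auto simp: number_bound_def intro: self_le_power)
  show "2 * n ^ s \<le> number_bound p q s n" "n \<le> number_bound p q s n"
    by (simp_all add: number_bound_def)
  have Z: "(n ^ p + 2) ^ q \<le> (n + 1) * (n ^ p + 2) ^ q" by simp
  with X Y show "n ^ p + 2 \<le> number_bound p q s n" by linarith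
  have "b ^ q \<le> (n ^ p + 2) ^ q" if "b \<le> n ^ p + 1"
    using that by (intro power_mono) auto
  then show "b \<le> n ^ p + 1 \<Longrightarrow> b ^ q \<le> number_bound p q s n"
    using X Z by fastforce
  have "n * fuel p q n \<le> (n + 1) * (n ^ p + 2) ^ q"
    using fuel_le[OF assms, of p n] Y by (intro mult_le_mono) linarith+
  with X show "n * fuel p q n \<le> number_bound p q s n" by linarith
qed

section \<open>Correctness and cost of the assembled program\<close>

lemma wp_fuel_com:
  assumes q: "1 \<le> q" and R: "R 0 = n" "R 1 = 1" "R 3 = 0" and D: "D = number_bound p q s n"
    and Q: "\<And>R'. eqoff {3, 6, 7, 8} R R' \<Longrightarrow> R' 3 = fuel p q n \<Longrightarrow> Q R' M (t + fuel p q n)"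
  shows "wp D (fuel_com p q) Q R M t"
proof -
  \<comment> \<open>The first alternative is the state before any round, where register 8 was set to
    1 without a comparison.\<close>
  define J where "J R' M' u \<longleftrightarrow> M' = M \<and> eqoff {3, 6, 7, 8} R R' \<and> u = t + R' 3 \<and> R' 6 = n ^ p + 1 \<and>
    (R' 3 = 0 \<and> R' 8 = 1 \<or> 1 \<le> R' 3 \<and> (R' 3 - 1) ^ q \<le> n ^ p \<and> R' 8 = n ^ p + 1 - R' 3 ^ q)"
    for R' M' :: "nat \<Rightarrow> nat" and u
  have D': "n ^ p + 2 \<le> D" "\<And>b. b \<le> n ^ p + 1 \<Longrightarrow> b ^ q \<le> D"
    using number_bound[OF q] by (simp_all add: D)
  have body: "wp D (Seq (Op Add 3 3 1) (Seq (Const 7 1) (Seq (mulpow 7 3 q) (Op Sub 8 6 7))))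
      (\<lambda>R' M' u. J R' M' u \<and> n ^ p + 1 - R' 3 < n ^ p + 1 - R1 3) R1 M1 (Suc u)"
    if "J R1 M1 u" "R1 8 \<noteq> 0" for R1 M1 u
  proof -
    note J = that(1)[unfolded J_def]
    have le: "R1 3 \<le> n ^ p" and pw: "R1 3 ^ q \<le> n ^ p"
    proof -
      show pw: "R1 3 ^ q \<le> n ^ p" using J that(2) q by (auto simp: power_0_left)
      show "R1 3 \<le> n ^ p"
      proof (cases "R1 3 = 0")
        case False
        then have "R1 3 \<le> R1 3 ^ q" using q by (intro self_le_power) auto
        with pw show ?thesis by linarith
      qed simp
    qed
    let ?R = "R1(3 := Suc (R1 3), 7 := 1)"
    have R1: "R1 1 = 1" "R1 6 = n ^ p + 1" "M1 = M" using J R by (auto simp: eqoff_def)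
    have "wp D (mulpow 7 3 q) (wp D (Op Sub 8 6 7)
      (\<lambda>R' M' u. J R' M' u \<and> n ^ p + 1 - R' 3 < n ^ p + 1 - R1 3)) ?R M (Suc u)"
      by (rule wp_mulpow) (use D'(1) D'(2)[of "Suc (R1 3)"] le pw J in \<open>auto simp: J_def eqoff_def\<close>)
    then show ?thesis using R1 le D'(1) by simp
  qed
  let ?R = "R(6 := n ^ p + 1, 8 := 1)"
  have "wp D (While 8 (Seq (Op Add 3 3 1) (Seq (Const 7 1) (Seq (mulpow 7 3 q) (Op Sub 8 6 7)))))
      (\<lambda>R' M' u. J R' M' u \<and> R' 8 = 0) ?R M t"
    by (rule wp_While[where I = J and \<mu> = "\<lambda>R'. n ^ p + 1 - R' 3"])
      (use R body in \<open>auto simp: J_def eqoff_def\<close>)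
  then have "wp D (While 8 (Seq (Op Add 3 3 1) (Seq (Const 7 1) (Seq (mulpow 7 3 q) (Op Sub 8 6 7)))))
      Q ?R M t"
  proof (elim wp_mono)
    fix R1 M1 u assume J: "J R1 M1 u \<and> R1 8 = 0"
    then have "n ^ p < R1 3 ^ q" "(R1 3 - 1) ^ q \<le> n ^ p" by (auto simp: J_def)
    then have "fuel p q n = R1 3" by (rule fuel_eqI)
    with J show "Q R1 M1 u" using Q[of R1] by (simp add: J_def)
  qed
  then have "wp D (mulpow 6 0 p) (wp D (Seq (Op Add 6 6 1) (Seq (Const 8 1)
     (While 8 (Seq (Op Add 3 3 1) (Seq (Const 7 1) (Seq (mulpow 7 3 q) (Op Sub 8 6 7))))))) Q) (R(6 := 1)) M t"
    by (intro wp_mulpow) (use R D' in \<open>simp_all add: fun_upd_twist\<close>)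
  then show ?thesis using D' by (simp add: fuel_com_def)
qed

lemma wp_table_com:
  assumes R: "context_ok s n [] R" and D: "2 * n ^ s \<le> D" and M: "\<forall>a<n ^ s. M a = input_mem s n E a"
    and Q: "\<And>R' M'. eqoff {6, 7, 8} R R' \<Longrightarrow> table s n E M' \<Longrightarrow> Q R' M' (t + n ^ s)"
  shows "wp D table_com Q R M t"
proof -
  let ?N = "n ^ s"
  define J where "J R' M' u \<longleftrightarrow> eqoff {6, 7, 8} R R' \<and> R' 7 \<le> ?N \<and> u + R' 7 = t + ?N \<and>
     (\<forall>a<?N. M' a = input_mem s n E a) \<and> (\<forall>a. R' 7 \<le> a \<and> a \<le> ?N \<longrightarrow> next_edge s n E a (M' (?N + a))) \<and>
     next_edge s n E (R' 7) (R' 6)"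
    for R' M' :: "nat \<Rightarrow> nat" and u
  have body: "wp D (Seq (Op Sub 7 7 1) (Seq (Load 8 7) (Seq (If 8 (Op Add 6 7 2) Skip)
       (Seq (Op Add 8 5 7) (Store 6 8))))) (\<lambda>R' M' u. J R' M' u \<and> R' 7 < R1 7) R1 M1 (Suc u)"
    if "J R1 M1 u" "R1 7 \<noteq> 0" for R1 M1 u
  proof -
    note J = that(1)[unfolded J_def]
    define a where "a = R1 7 - 1"
    have a: "R1 7 = Suc a" "a < ?N" using J that(2) by (auto simp: a_def)
    have R1: "R1 1 = 1" "R1 2 = 0" "R1 5 = ?N" using J R by (auto simp: eqoff_def context_ok_def)
    have Ma: "M1 a = input_mem s n E a" using J a by blast
    have bounds: "a \<le> D" "?N + a \<le> D" using a D by linarith+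
    define y where "y = (if M1 a = 0 then R1 6 else a)"
    have y: "next_edge s n E a y"
    proof (cases "M1 a = 0")
      case True
      have "next_edge s n E (Suc a) (R1 6)" using J a by simp
      moreover have "input_mem s n E b = 0" if "a \<le> b" "b < R1 6" for b
        using calculation that True Ma by (cases "b = a") (auto simp: next_edge_def)
      ultimately show ?thesis using True by (auto simp: y_def next_edge_def)
    next
      case False
      with a Ma show ?thesis by (simp add: y_def next_edge_def)
    qed
    let ?R = "R1(7 := a, 8 := M1 a, 6 := y, 8 := ?N + a)"
    have "next_edge s n E b ((M1(?N + a := y)) (?N + b))" if "a \<le> b" "b \<le> ?N" for b
      using that y J a by (cases "b = a") auto
    then have "J ?R (M1(?N + a := y)) (Suc u)"
      unfolding J_def using J a y by (auto simp: eqoff_def)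
    then have "J (R1(7 := a, 8 := ?N + a, 6 := y)) (M1(?N + a := y)) (Suc u)"
      by (simp add: fun_upd_twist)
    then show ?thesis
      using bounds a R1 by (cases "M1 a = 0") (simp_all add: y_def fun_upd_twist fun_upd_idem)
  qed
  have R': "R 2 = 0" "R 5 = ?N" using R by (simp_all add: context_ok_def)
  have "J (R(6 := ?N, 7 := ?N, 8 := ?N + ?N)) (M(?N + ?N := ?N)) t"
    unfolding J_def using M by (auto simp: eqoff_def next_edge_def)
  then have "wp D (While 7 (Seq (Op Sub 7 7 1) (Seq (Load 8 7) (Seq (If 8 (Op Add 6 7 2) Skip)
       (Seq (Op Add 8 5 7) (Store 6 8)))))) (\<lambda>R' M' u. J R' M' u \<and> R' 7 = 0)
       (R(6 := ?N, 7 := ?N, 8 := ?N + ?N)) (M(?N + ?N := ?N)) t"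
    by (rule wp_While[where I = J and \<mu> = "\<lambda>R'. R' 7"]) (rule body)
  then have "wp D (While 7 (Seq (Op Sub 7 7 1) (Seq (Load 8 7) (Seq (If 8 (Op Add 6 7 2) Skip)
       (Seq (Op Add 8 5 7) (Store 6 8)))))) Q
       (R(6 := ?N, 7 := ?N, 8 := ?N + ?N)) (M(?N + ?N := ?N)) t"
  proof (elim wp_mono)
    fix R1 M1 u assume J: "J R1 M1 u \<and> R1 7 = 0"
    then have "Q R1 M1 (t + ?N)" by (intro Q) (auto simp: J_def table_def)
    moreover have "u = t + ?N" using J by (simp add: J_def)
    ultimately show "Q R1 M1 u" by simp
  qed
  then show ?thesis using D R' by (simp add: table_com_def)
qed

text \<open>The iterations are \<open>n ^ s\<close> for the table, \<open>fuel p q n\<close> for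
  finding the cutoff and at most as many for the search. The work must be strictly below the fuel,
  because the count is known to be exact only if fuel is left over.\<close>

lemma wp_clique_count:
  assumes s: "2 \<le> s" and q: "1 \<le> q" and D: "D = number_bound p q s n"
    and E: "nsets {} s \<subseteq> E"
    and d: "\<And>vs. ordered_clique n E s vs \<Longrightarrow> length vs < k \<Longrightarrow> card (candidates n E s vs) \<le> d (length vs)"
  shows "wp D (clique_count p q s k) (\<lambda>R' M' u. u \<le> n ^ s + 2 * fuel p q n \<and>
      ((\<Sum>m<k. num_cliques {..<n} E s m * d m) < fuel p q n \<longrightarrow> R' 0 = num_cliques {..<n} E s k))
     ((\<lambda>_. 0)(0 := n)) (input_mem s n E) 0"
    (is "wp D _ ?Q _ _ 0")
proof -
  let ?B = "fuel p q n" and ?M = "input_mem s n E"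
  note nb = number_bound[OF q, where p = p and s = s and n = n, folded D]
  have D1: "1 \<le> D" "?B + 1 \<le> D" "n ^ s \<le> D"
    using nb(1,3) fuel_le[OF q, of p n] by linarith+
  have srch: "wp D (search s k 0) (wp D (Op Add 0 4 2) ?Q) R M (?B + n ^ s)"
    if cx: "context_ok s n [] R" and R: "R 3 = ?B" "R 4 = 0" and tab: "table s n E M" for R M
  proof -
    have oc: "ordered_clique n E s []" using E by (simp add: ordered_clique_def)
    have "wp D (search s k (length ([]::nat list))) (wp D (Op Add 0 4 2) ?Q) R M (?B + n ^ s)"
    proof (rule wp_search[OF s nb(1) nb(5) nb(2) D1(2) tab d oc _ cx, where k = k])
      show "R 4 + R 3 \<le> ?B" using R by simp
      fix R' u assume R': "context_ok s n [] R'" "R' 3 \<le> R 3"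
        "R' 3 > 0 \<Longrightarrow> R' 4 = R 4 + card (extensions n E s (set []) k)"
        "R 3 \<le> R' 3 + (\<Sum>m=length ([]::nat list)..<k. card (extensions n E s (set []) m) * d m)"
        "R' 4 + R' 3 \<le> R 4 + R 3 + of_bool (k = 0)" "u + R' 3 \<le> ?B + n ^ s + R 3"
      have "of_bool (k = 0) \<le> (1::nat)" by simp
      then have "R' 4 \<le> D" "R' 2 = 0" using R' D1 R by (simp_all add: context_ok_def)
      moreover have "(\<Sum>m<k. num_cliques {..<n} E s m * d m) < ?B \<Longrightarrow> R' 3 > 0"
        using R'(4) R by (simp add: extensions_empty num_cliques_def atLeast0LessThan)
      ultimately show "wp D (Op Add 0 4 2) ?Q R' M u"
        using R' R by (auto simp: extensions_empty num_cliques_def)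
    qed simp_all
    then show ?thesis by simp
  qed
  let ?R = "((\<lambda>_. 0)(0 := n, 1 := 1, 5 := n ^ s)) :: nat \<Rightarrow> nat"
  have "wp D (fuel_com p q) (wp D (Seq table_com (Seq (search s k 0) (Op Add 0 4 2))) ?Q) ?R ?M 0"
  proof (rule wp_fuel_com[OF q _ _ _ D])
    fix R assume R: "eqoff {3, 6, 7, 8} ?R R" "R 3 = ?B"
    have cx: "context_ok s n [] R" using R(1) by (auto simp: eqoff_def context_ok_def)
    have "wp D table_com (wp D (search s k 0) (wp D (Op Add 0 4 2) ?Q)) R ?M ?B"
    proof (rule wp_table_com[OF cx nb(1)])
      fix R' M' assume R': "eqoff {6, 7, 8} R R'" "table s n E M'"
      have cx': "context_ok s n [] R'"
        by (rule context_ok_eqoff[OF cx]) (use R'(1) in \<open>auto simp: eqoff_def\<close>)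
      show "wp D (search s k 0) (wp D (Op Add 0 4 2) ?Q) R' M' (?B + n ^ s)"
        by (rule srch[OF cx' _ _ R'(2)]) (use R R'(1) in \<open>auto simp: eqoff_def\<close>)
    qed simp
    then show "wp D (Seq table_com (Seq (search s k 0) (Op Add 0 4 2))) ?Q R ?M (0 + ?B)" by simp
  qed simp_all
  then have "wp D (mulpow 5 0 s) (wp D (Seq (fuel_com p q) (Seq table_com
      (Seq (search s k 0) (Op Add 0 4 2)))) ?Q) ((\<lambda>_. 0)(0 := n, 1 := 1, 5 := 1)) ?M 0"
    by (intro wp_mulpow) (use D1 in simp_all)
  then show ?thesis using D1 by (simp add: clique_count_def)
qed

definition time_bound :: "nat \<Rightarrow> nat \<Rightarrow> nat \<Rightarrow> nat \<Rightarrow> nat \<Rightarrow> nat" where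
  "time_bound p q s k n = com_size (clique_count p q s k) * (n ^ s + 2 * fuel p q n + 1) *
     (1 + 3 * len (number_bound p q s n))"

text \<open>The time bound does not mention \<open>d\<close>: the constant \<open>n\<close> serves
  for arbitrary hypergraphs, and a sharper \<open>d\<close> yields correctness on those with few
  extensions.\<close>

lemma clique_count_steps:
  assumes s: "2 \<le> s" and q: "1 \<le> q"
    and d: "\<And>vs. ordered_clique n E s vs \<Longrightarrow> length vs < k \<Longrightarrow> card (candidates n E s vs) \<le> d (length vs)"
  shows "\<exists>R' M' t'. steps (time_bound p q s k n) (init_config (clique_count p q s k) s n E) =
      return_pmf ([], R', M', t') \<and> t' \<le> time_bound p q s k n \<and>
      ((\<Sum>m<k. num_cliques {..<n} E s m * d m) < fuel p q n \<longrightarrow> R' 0 = num_cliques {..<n} E s k)"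
  unfolding init_config_def
proof (rule wp_steps[OF _ _ _ time_bound_def])
  have "nsets {} s \<subseteq> E" using s by (auto simp: nsets_def)
  then show "wp (number_bound p q s n) (clique_count p q s k) (\<lambda>R' M' u. u \<le> n ^ s + 2 * fuel p q n \<and>
      ((\<Sum>m<k. num_cliques {..<n} E s m * d m) < fuel p q n \<longrightarrow> R' 0 = num_cliques {..<n} E s k))
     ((\<lambda>_. 0)(0 := n)) (input_mem s n E) 0"
    by (rule wp_clique_count[OF s q refl _ d])
qed (use number_bound(2,3)[OF q, of n p s] in \<open>auto simp: input_mem_def\<close>)

lemma runs_in_time_clique_count:
  assumes "2 \<le> s" "1 \<le> q"
  shows "runs_in_time (clique_count p q s k) s (time_bound p q s k)"
  unfolding runs_in_time_def
proof (intro allI impI)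
  fix n E
  have "card (candidates n E s vs) \<le> n" for vs
    using card_mono[of "{..<n}" "candidates n E s vs"] by (auto simp: candidates_def)
  from clique_count_steps[OF assms, of n E k "\<lambda>_. n" p, OF this]
  show "\<forall>(K, R, M, t)\<in>set_pmf (steps (time_bound p q s k n) (init_config (clique_count p q s k) s n E)).
      K = [] \<and> t \<le> time_bound p q s k n"
    by auto
qed

subsection \<open>Common extensions in random hypergraphs\<close>

text \<open>A single term of the exponential series. At \<open>x = m\<close> it plays the part of
  Stirling's formula.\<close>

lemma power_div_fact_le_exp:
  fixes x :: real
  assumes "0 \<le> x"
  shows "x ^ m / fact m \<le> exp x"
proof -
  have "(\<Sum>i\<in>{m}. x ^ i /\<^sub>R fact i) \<le> (\<Sum>i. x ^ i /\<^sub>R fact i)"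
    by (rule sum_le_suminf) (use assms summable_exp_generic[of x] in auto)
  then show ?thesis by (simp add: exp_def divide_inverse mult.commute)
qed

lemma prob_ER_superset:
  assumes F: "F \<subseteq> nsets {..<n} s" and p: "0 \<le> p" "p \<le> 1"
  shows "measure_pmf.prob (ER_hypergraph n p s) {E. F \<subseteq> E} = p ^ card F"
proof -
  let ?A = "nsets {..<n} s"
  have fin: "finite ?A" by (simp add: finite_imp_finite_nsets)
  have "measure_pmf.prob (ER_hypergraph n p s) {E. F \<subseteq> E} =
      measure_pmf.prob (Pi_pmf ?A False (\<lambda>_. bernoulli_pmf p)) (Pi ?A (\<lambda>e. if e \<in> F then {True} else UNIV))"
    unfolding ER_hypergraph_def measure_map_pmf
    by (rule arg_cong[where f = "measure_pmf.prob _"]) (use F in \<open>auto simp: Pi_def split: if_splits\<close>)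
  also have "\<dots> = (\<Prod>e\<in>?A. if e \<in> F then p else 1)"
    using p by (subst measure_Pi_pmf_Pi[OF fin])
      (auto intro!: prod.cong simp: measure_pmf_single)
  also have "\<dots> = (\<Prod>e\<in>F. p)"
    using F fin by (subst prod.inter_restrict[symmetric]) (auto simp: Int_absorb1)
  finally show ?thesis by simp
qed

lemma set_ER_hypergraph: "E \<in> set_pmf (ER_hypergraph n p s) \<Longrightarrow> uniform_hypergraph {..<n} E s"
  by (auto simp: ER_hypergraph_def uniform_hypergraph_def)

definition common_ext :: "nat \<Rightarrow> nat set set \<Rightarrow> nat \<Rightarrow> nat set \<Rightarrow> nat set" where
  "common_ext n E s W = {v \<in> {..<n} - W. \<forall>U\<in>nsets W (s - 1). insert v U \<in> E}"

lemma finite_common_ext [simp]: "finite (common_ext n E s W)"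
  by (simp add: common_ext_def)

text \<open>Union bound over the \<open>r\<close>-sets \<open>S\<close> of possible extensions. Each
  forces \<open>r * (j choose (s - 1))\<close> edges, which are distinct because the vertex from
  \<open>S\<close> is the only one of its edge outside \<open>W\<close>.\<close>

lemma prob_common_ext_ge:
  assumes W: "W \<in> nsets {..<n} j" and p: "0 \<le> p" "p \<le> 1" and s: "1 \<le> s"
  shows "measure_pmf.prob (ER_hypergraph n p s) {E. r \<le> card (common_ext n E s W)} \<le>
    real (n choose r) * (p ^ (j choose (s - 1))) ^ r"
proof -
  let ?V = "{..<n} - W" and ?N = "nsets W (s - 1)"
  let ?M = "measure_pmf (ER_hypergraph n p s)"
  define F where "F S = (\<lambda>(v, U). insert v U) ` (S \<times> ?N)" for S
  have W': "W \<subseteq> {..<n}" "finite W" "card W = j" using W by (auto simp: nsets_def)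
  have cF: "card (F S) = r * (j choose (s - 1))" "F S \<subseteq> nsets {..<n} s" if "S \<in> nsets ?V r" for S
  proof -
    have S: "S \<subseteq> ?V" "card S = r" using that by (auto simp: nsets_def)
    have "inj_on (\<lambda>(v, U). insert v U) (S \<times> ?N)"
    proof (rule inj_onI, clarify)
      fix v U v' U'
      assume *: "v \<in> S" "U \<in> ?N" "v' \<in> S" "U' \<in> ?N" "insert v U = insert v' U'"
      then have "v \<notin> W" "v' \<notin> W" "U \<subseteq> W" "U' \<subseteq> W" using S by (auto simp: nsets_def)
      then have "v = v'" "U = insert v U - {v}" "U' = insert v' U' - {v'}" using *(5) by blast+
      with *(5) show "v = v' \<and> U = U'" by metis
    qed
    then show "card (F S) = r * (j choose (s - 1))"
      unfolding F_def using S W' by (simp add: card_image card_cartesian_product)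
    show "F S \<subseteq> nsets {..<n} s"
      unfolding F_def using S W' s by (fastforce simp: nsets_def card_insert_if)
  qed
  have fin: "finite (nsets ?V r)" by (simp add: finite_imp_finite_nsets)
  have "{E. r \<le> card (common_ext n E s W)} \<subseteq> (\<Union>S\<in>nsets ?V r. {E. F S \<subseteq> E})"
  proof
    fix E assume "E \<in> {E. r \<le> card (common_ext n E s W)}"
    then obtain S where "S \<subseteq> common_ext n E s W" "card S = r"
      using obtain_subset_with_card_n[of r "common_ext n E s W"] by auto
    then have "S \<in> nsets ?V r" "F S \<subseteq> E"
      by (auto simp: nsets_def common_ext_def F_def intro: finite_subset)
    then show "E \<in> (\<Union>S\<in>nsets ?V r. {E. F S \<subseteq> E})" by blast
  qed
  then have "measure ?M {E. r \<le> card (common_ext n E s W)} \<le> measure ?M (\<Union>S\<in>nsets ?V r. {E. F S \<subseteq> E})"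
    by (intro measure_pmf.finite_measure_mono) auto
  also have "\<dots> \<le> (\<Sum>S\<in>nsets ?V r. measure ?M {E. F S \<subseteq> E})"
    by (rule measure_pmf.finite_measure_subadditive_finite) (use fin in auto)
  also have "\<dots> = (\<Sum>S\<in>nsets ?V r. p ^ (r * (j choose (s - 1))))"
    by (rule sum.cong) (use cF p in \<open>simp_all add: prob_ER_superset\<close>)
  also have "\<dots> = real (card ?V choose r) * p ^ (r * (j choose (s - 1)))" by simp
  also have "\<dots> \<le> real (n choose r) * p ^ (r * (j choose (s - 1)))"
  proof -
    have "card ?V \<le> n" using card_mono[of "{..<n}" ?V] by auto
    then have "card ?V choose r \<le> n choose r" by (rule binomial_right_mono)
    then show ?thesis by (intro mult_right_mono) (use p in auto)
  qed
  finally show ?thesis by (simp add: power_mult[symmetric] mult.commute)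
qed

text \<open>With \<open>x = p ^ (j choose (s - 1))\<close> the union bound is at most
  \<open>(n * x) ^ r / fact r\<close>. The constant \<open>2 * exp 1\<close> gives
  \<open>n * x \<le> r / (2 * exp 1)\<close>, and \<open>r ^ r / fact r \<le> exp r\<close> then
  leaves \<open>(1 / 2) ^ r\<close>.\<close>

lemma prob_common_ext_gt:
  assumes W: "W \<in> nsets {..<n} j" and p: "0 \<le> p" "p \<le> 1" and s: "1 \<le> s"
    and t: "0 \<le> t" "2 * exp 1 * (real n * p ^ (j choose (s - 1))) \<le> t"
  shows "measure_pmf.prob (ER_hypergraph n p s) {E. t < real (card (common_ext n E s W))} \<le>
    (1 / 2) powr t"
proof -
  let ?x = "p ^ (j choose (s - 1))"
  define r where "r = nat \<lceil>t\<rceil>"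
  have r: "t \<le> real r" unfolding r_def by linarith
  have "real (n choose r) * fact r \<le> real n ^ r"
    using of_nat_mono[OF binomial_fact_pow[of n r], where 'a = real] by simp
  then have "real (n choose r) \<le> real n ^ r / fact r" by (simp add: field_simps)
  have "measure_pmf.prob (ER_hypergraph n p s) {E. t < real (card (common_ext n E s W))} \<le>
      measure_pmf.prob (ER_hypergraph n p s) {E. r \<le> card (common_ext n E s W)}"
    unfolding r_def by (intro measure_pmf.finite_measure_mono) (auto simp: nat_le_iff ceiling_le_iff)
  also have "\<dots> \<le> real (n choose r) * ?x ^ r" by (rule prob_common_ext_ge[OF W p s])
  also have "\<dots> \<le> real n ^ r / fact r * ?x ^ r"
    by (rule mult_right_mono) (use \<open>real (n choose r) \<le> _\<close> p in auto)
  also have "\<dots> = (real n * ?x) ^ r / fact r" by (simp add: power_mult_distrib)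
  also have "\<dots> \<le> (real r / (2 * exp 1)) ^ r / fact r"
  proof (intro divide_right_mono power_mono)
    have "2 * exp 1 * (real n * ?x) \<le> real r" using t(2) r by linarith
    then show "real n * ?x \<le> real r / (2 * exp 1)" by (simp add: field_simps)
  qed (use p in auto)
  also have "\<dots> = (1 / (2 * exp 1)) ^ r * (real r ^ r / fact r)"
    by (simp add: power_divide)
  also have "\<dots> \<le> (1 / (2 * exp 1)) ^ r * exp (real r)"
    by (rule mult_left_mono[OF power_div_fact_le_exp]) auto
  also have "\<dots> = (1 / 2) ^ r"
  proof -
    have "exp (real r) = exp 1 ^ r" by (simp flip: exp_of_nat_mult)
    then show ?thesis by (simp add: power_divide power_mult_distrib)
  qed
  also have "\<dots> = (1 / 2) powr real r" by (simp add: powr_realpow)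
  also have "\<dots> \<le> (1 / 2) powr t" by (rule powr_mono') (use r in auto)
  finally show ?thesis .
qed

section \<open>Simultaneous bounds on extensions and clique numbers\<close>

definition few_extensions :: "nat \<Rightarrow> nat set set \<Rightarrow> nat \<Rightarrow> nat \<Rightarrow> (nat \<Rightarrow> real) \<Rightarrow> bool" where
  "few_extensions n E s k b \<longleftrightarrow>
     (\<forall>j<k. \<forall>W\<in>nsets {..<n} j. real (card (common_ext n E s W)) \<le> b j)"

lemma prob_not_few_extensions:
  assumes n: "1 \<le> n" and p: "0 \<le> p" "p \<le> 1" and s: "1 \<le> s"
    and b: "\<And>j. j < k \<Longrightarrow> 2 * exp 1 * (real n * p ^ (j choose (s - 1))) \<le> b j"
    and t: "\<And>j. j < k \<Longrightarrow> t \<le> b j" "0 \<le> t"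
  shows "measure_pmf.prob (ER_hypergraph n p s) {E. \<not> few_extensions n E s k b} \<le>
    real k * real n ^ k * (1 / 2) powr t"
proof -
  let ?M = "measure_pmf (ER_hypergraph n p s)"
  let ?X = "\<lambda>j W. {E. b j < real (card (common_ext n E s W))}"
  have fin: "finite (nsets {..<n} j)" for j by (simp add: finite_imp_finite_nsets)
  have "{E. \<not> few_extensions n E s k b} = (\<Union>j\<in>{..<k}. \<Union>W\<in>nsets {..<n} j. ?X j W)"
    by (auto simp: few_extensions_def not_le)
  then have "measure ?M {E. \<not> few_extensions n E s k b} \<le>
      (\<Sum>j<k. measure ?M (\<Union>W\<in>nsets {..<n} j. ?X j W))"
    by (simp only:) (rule measure_pmf.finite_measure_subadditive_finite, auto)
  also have "\<dots> \<le> (\<Sum>j<k. real n ^ k * (1 / 2) powr t)"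
  proof (rule sum_mono)
    fix j assume "j \<in> {..<k}"
    then have j: "j < k" by simp
    have "measure ?M (\<Union>W\<in>nsets {..<n} j. ?X j W) \<le> (\<Sum>W\<in>nsets {..<n} j. measure ?M (?X j W))"
      by (rule measure_pmf.finite_measure_subadditive_finite) (use fin in auto)
    also have "\<dots> \<le> (\<Sum>W\<in>nsets {..<n} j. (1 / 2) powr t)"
    proof (rule sum_mono)
      fix W assume "W \<in> nsets {..<n} j"
      then have "measure ?M (?X j W) \<le> (1 / 2) powr b j"
        by (rule prob_common_ext_gt[OF _ p s _ b[OF j]]) (use t(1)[OF j] t(2) in linarith)
      also have "\<dots> \<le> (1 / 2) powr t" by (rule powr_mono') (use t(1)[OF j] in auto)
      finally show "measure ?M (?X j W) \<le> (1 / 2) powr t" .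
    qed
    also have "\<dots> = real (n choose j) * (1 / 2) powr t" by simp
    also have "\<dots> \<le> real n ^ k * (1 / 2) powr t"
    proof (rule mult_right_mono)
      have "n choose j \<le> n ^ j"
        using binomial_fact_pow[of n j] fact_ge_1[of j, where 'a = nat]
        by (metis dual_order.trans mult.right_neutral mult_le_mono2)
      also have "\<dots> \<le> n ^ k" using n j by (intro power_increasing) auto
      finally show "real (n choose j) \<le> real n ^ k" by (simp flip: of_nat_power)
    qed simp
    finally show "measure ?M (\<Union>W\<in>nsets {..<n} j. ?X j W) \<le> real n ^ k * (1 / 2) powr t" .
  qed
  finally show ?thesis by simp
qed

text \<open>Deleting any vertex of a clique leaves a smaller clique of which that vertex is a common
  extension. Each clique is counted once per vertex, a constant factor that the exponents do not
  feel.\<close>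

lemma num_cliques_Suc_le:
  "num_cliques {..<n} E s (Suc j) \<le> (\<Sum>W\<in>cliques {..<n} E s j. card (common_ext n E s W))" if "1 \<le> s"
proof -
  have fin: "finite (cliques {..<n} E s j)" for j
    unfolding cliques_def by (simp add: finite_imp_finite_nsets)
  have "cliques {..<n} E s (Suc j) \<subseteq>
      (\<Union>W\<in>cliques {..<n} E s j. (\<lambda>v. insert v W) ` common_ext n E s W)"
  proof
    fix X assume X: "X \<in> cliques {..<n} E s (Suc j)"
    then have X': "X \<subseteq> {..<n}" "finite X" "card X = Suc j" "nsets X s \<subseteq> E"
      by (auto simp: cliques_def nsets_def)
    then obtain v where v: "v \<in> X" by fastforce
    let ?W = "X - {v}"
    have "?W \<in> cliques {..<n} E s j"
      using X' v nsets_mono[of ?W X s] by (auto simp: cliques_def nsets_def)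
    moreover have "insert v U \<in> E" if "U \<in> nsets ?W (s - 1)" for U
    proof -
      have "insert v U \<in> nsets X s"
        using that v \<open>1 \<le> s\<close> by (auto simp: nsets_def card_insert_if)
      with X' show ?thesis by blast
    qed
    then have "v \<in> common_ext n E s ?W" using X' v by (auto simp: common_ext_def)
    moreover have "X = insert v ?W" using v by auto
    ultimately show "X \<in> (\<Union>W\<in>cliques {..<n} E s j. (\<lambda>v. insert v W) ` common_ext n E s W)"
      by blast
  qed
  then have "num_cliques {..<n} E s (Suc j) \<le>
      card (\<Union>W\<in>cliques {..<n} E s j. (\<lambda>v. insert v W) ` common_ext n E s W)"
    unfolding num_cliques_def by (intro card_mono) (use fin in auto)
  also have "\<dots> \<le> (\<Sum>W\<in>cliques {..<n} E s j. card ((\<lambda>v. insert v W) ` common_ext n E s W))"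
    by (rule card_UN_le[OF fin])
  also have "\<dots> \<le> (\<Sum>W\<in>cliques {..<n} E s j. card (common_ext n E s W))"
    by (intro sum_mono card_image_le) simp
  finally show ?thesis .
qed

lemma num_cliques_0: "1 \<le> s \<Longrightarrow> num_cliques {..<n} E s 0 = 1"
proof -
  assume "1 \<le> s"
  then have "cliques {..<n} E s 0 = {{}}" by (auto simp: cliques_def nsets_empty_iff)
  then show ?thesis by (simp add: num_cliques_def)
qed

lemma num_cliques_le_prod:
  assumes s: "1 \<le> s" and few: "few_extensions n E s k b" and "j \<le> k"
    and nonneg: "\<And>j. 0 \<le> b j"
  shows "real (num_cliques {..<n} E s j) \<le> (\<Prod>i<j. b i)"
  using \<open>j \<le> k\<close>
proof (induction j)
  case 0
  then show ?case using s by (simp add: num_cliques_0)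
next
  case (Suc j)
  have b: "real (card (common_ext n E s W)) \<le> b j" if "W \<in> cliques {..<n} E s j" for W
    using few that Suc.prems by (auto simp: few_extensions_def cliques_def)
  have "real (num_cliques {..<n} E s (Suc j)) \<le>
      real (\<Sum>W\<in>cliques {..<n} E s j. card (common_ext n E s W))"
    using num_cliques_Suc_le[OF s] by (simp only: of_nat_le_iff)
  also have "\<dots> \<le> (\<Sum>W\<in>cliques {..<n} E s j. b j)"
    unfolding of_nat_sum by (rule sum_mono) (rule b)
  also have "\<dots> = real (num_cliques {..<n} E s j) * b j" by (simp add: num_cliques_def)
  also have "\<dots> \<le> (\<Prod>i<j. b i) * b j"
    using Suc nonneg[of j] by (intro mult_right_mono) auto
  finally show ?case by simp
qed

subsection \<open>Success probability and running time\<close>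

text \<open>The output is a point mass for each input, so the success probability is taken over the
  inputs alone; hypergraphs that are not \<open>s\<close>-uniform have probability 0.\<close>

lemma success_prob_ge:
  assumes "\<And>E. uniform_hypergraph {..<n} E s \<Longrightarrow>
    \<exists>R M t. steps (T n) (init_config P s n E) = return_pmf ([], R, M, t) \<and>
      (G E \<longrightarrow> R 0 = num_cliques {..<n} E s k)"
  shows "success_prob P k s T c n \<ge> measure_pmf.prob (ER_hypergraph n (c n) s) {E. G E}"
proof -
  let ?M = "ER_hypergraph n (c n) s"
  have "\<forall>E. \<exists>v. uniform_hypergraph {..<n} E s \<longrightarrow>
      output_pmf P s T n E = return_pmf v \<and> (G E \<longrightarrow> v = num_cliques {..<n} E s k)"
  proof
    fix E
    show "\<exists>v. uniform_hypergraph {..<n} E s \<longrightarrow>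
        output_pmf P s T n E = return_pmf v \<and> (G E \<longrightarrow> v = num_cliques {..<n} E s k)"
    proof (cases "uniform_hypergraph {..<n} E s")
      case True
      from assms[OF this] obtain R M t where
        "steps (T n) (init_config P s n E) = return_pmf ([], R, M, t)"
        "G E \<longrightarrow> R 0 = num_cliques {..<n} E s k" by blast
      then show ?thesis by (intro exI[of _ "R 0"]) (simp add: output_pmf_def)
    qed simp
  qed
  then obtain v where v: "\<And>E. uniform_hypergraph {..<n} E s \<Longrightarrow> output_pmf P s T n E = return_pmf (v E)"
    "\<And>E. uniform_hypergraph {..<n} E s \<Longrightarrow> G E \<Longrightarrow> v E = num_cliques {..<n} E s k"
    by metis
  have "bind_pmf ?M (\<lambda>E. bind_pmf (output_pmf P s T n E) (\<lambda>out. return_pmf (out = num_cliques {..<n} E s k))) =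
      bind_pmf ?M (\<lambda>E. return_pmf (v E = num_cliques {..<n} E s k))"
    by (rule bind_pmf_cong) (auto simp: v(1) set_ER_hypergraph bind_return_pmf)
  then have "success_prob P k s T c n = measure_pmf.prob ?M {E. v E = num_cliques {..<n} E s k}"
    unfolding success_prob_def map_pmf_def[symmetric] by (simp add: vimage_def)
  moreover have "measure_pmf.prob ?M {E. G E} \<le> measure_pmf.prob ?M {E. v E = num_cliques {..<n} E s k}"
    by (rule measure_pmf.finite_measure_mono_AE) (auto intro!: AE_pmfI v(2) set_ER_hypergraph)
  ultimately show ?thesis by simp
qed

lemma success_prob_le_1: "success_prob P k s T c n \<le> 1"
  unfolding success_prob_def by (rule measure_pmf.prob_le_1)

text \<open>The witness is the set of the last \<open>s - 1\<close> vertices. It is its own only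
  \<open>(s - 1)\<close>-subset, so the single edge tested by \<open>candidate\<close> is the whole
  condition for a common extension.\<close>

lemma card_candidates_le_common_ext:
  assumes vs: "ordered_clique n E s vs" and len: "s - 1 \<le> length vs"
  shows "\<exists>U\<in>nsets {..<n} (s - 1). card (candidates n E s vs) \<le> card (common_ext n E s U)"
proof
  let ?us = "drop (length vs - (s - 1)) vs"
  have "distinct ?us" using ordered_clique_distinct[OF vs] by simp
  then have card: "card (set ?us) = s - 1" using distinct_card[of ?us] len by simp
  have sub: "set ?us \<subseteq> set vs" by (rule set_drop_subset)
  then show "set ?us \<in> nsets {..<n} (s - 1)"
    using vs card by (auto simp: ordered_clique_def nsets_def)
  have U: "U = set ?us" if "U \<in> nsets (set ?us) (s - 1)" for U
    using that card card_subset_eq[of "set ?us" U] by (auto simp: nsets_def)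
  have "candidates n E s vs \<subseteq> common_ext n E s (set ?us)"
  proof
    fix w assume w: "w \<in> candidates n E s vs"
    then have "\<forall>v\<in>set vs. v < w"
      using sorted_wrt_less_first_vertex[of vs w] vs by (simp add: ordered_clique_def candidates_def)
    then have "w \<notin> set ?us" using sub by auto
    with w len U show "w \<in> common_ext n E s (set ?us)"
      by (auto simp: common_ext_def candidates_def candidate_def)
  qed
  then show "card (candidates n E s vs) \<le> card (common_ext n E s (set ?us))"
    by (rule card_mono[OF finite_common_ext])
qed

text \<open>The value at \<open>s - 1\<close> serves all later depths, because candidates are
  filtered by \<open>s - 1\<close> vertices only. It is rounded to a natural number for the fuel
  accounting.\<close>

definition degree_bound :: "nat \<Rightarrow> nat \<Rightarrow> (nat \<Rightarrow> real) \<Rightarrow> nat \<Rightarrow> nat" where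
  "degree_bound s n b m = (if m < s - 1 then n else nat \<lfloor>b (s - 1)\<rfloor>)"

lemma card_candidates_le:
  assumes few: "few_extensions n E s k b" and k: "s \<le> k" "1 \<le> s" and vs: "ordered_clique n E s vs"
  shows "card (candidates n E s vs) \<le> degree_bound s n b (length vs)"
proof (cases "length vs < s - 1")
  case True
  have "card (candidates n E s vs) \<le> card {..<n}"
    by (rule card_mono) (auto simp: candidates_def)
  with True show ?thesis by (simp add: degree_bound_def)
next
  case False
  then obtain U where "U \<in> nsets {..<n} (s - 1)" "card (candidates n E s vs) \<le> card (common_ext n E s U)"
    using card_candidates_le_common_ext[OF vs] by auto
  moreover have "s - 1 < k" using k by linarith
  with few \<open>U \<in> _\<close> have "real (card (common_ext n E s U)) \<le> b (s - 1)"
    unfolding few_extensions_def by blast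
  ultimately have "real (card (candidates n E s vs)) \<le> b (s - 1)" by linarith
  with False show ?thesis by (simp add: degree_bound_def le_nat_floor)
qed

text \<open>Below depth \<open>s - 1\<close> there are at most \<open>n ^ m\<close> cliques with
  \<open>n\<close> candidates each, within \<open>n ^ s\<close>. From there on the extension bounds
  multiply; as the exponents are nonnegative, their sum up to \<open>k\<close> dominates every
  prefix.\<close>

lemma search_work_le:
  assumes n: "1 \<le> n" and few: "few_extensions n E s k b" and s: "2 \<le> s"
    and b: "\<And>j. b j = real n powr \<beta> j" and \<beta>: "\<And>j. 0 \<le> \<beta> j"
    and x: "real s \<le> x" "(\<Sum>j<k. \<beta> j) + \<beta> (s - 1) \<le> x"
  shows "real (\<Sum>m<k. num_cliques {..<n} E s m * degree_bound s n b m) \<le> real k * real n powr x"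
proof -
  have "real (num_cliques {..<n} E s m * degree_bound s n b m) \<le> real n powr x" if m: "m < k" for m
  proof (cases "m < s - 1")
    case True
    have "num_cliques {..<n} E s m \<le> card (nsets {..<n} m)"
      unfolding num_cliques_def cliques_def
      by (rule card_mono) (auto simp: finite_imp_finite_nsets)
    also have "\<dots> = n choose m" by simp
    also have "\<dots> \<le> n ^ m"
      using binomial_fact_pow[of n m] fact_ge_1[of m, where 'a = nat]
      by (metis dual_order.trans mult.right_neutral mult_le_mono2)
    finally have "num_cliques {..<n} E s m * degree_bound s n b m \<le> n ^ m * n"
      using True by (intro mult_le_mono) (auto simp: degree_bound_def)
    also have "\<dots> = n ^ Suc m" by simp
    also have "\<dots> \<le> n ^ s" using True n by (intro power_increasing) auto
    finally have "real (num_cliques {..<n} E s m * degree_bound s n b m) \<le> real n ^ s"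
      by (metis of_nat_le_iff of_nat_power)
    also have "\<dots> = real n powr real s" using n by (simp add: powr_realpow)
    also have "\<dots> \<le> real n powr x" using n x by (intro powr_mono) auto
    finally show ?thesis .
  next
    case False
    have "real (num_cliques {..<n} E s m) \<le> (\<Prod>i<m. b i)"
      by (rule num_cliques_le_prod[OF _ few]) (use s m b in auto)
    also have "\<dots> = real n powr (\<Sum>i<m. \<beta> i)"
      using n by (simp add: b powr_sum)
    also have "\<dots> \<le> real n powr (\<Sum>i<k. \<beta> i)"
      using n m \<beta> by (intro powr_mono sum_mono2) auto
    finally have "real (num_cliques {..<n} E s m) \<le> real n powr (\<Sum>i<k. \<beta> i)" .
    moreover have "real (degree_bound s n b m) \<le> real n powr \<beta> (s - 1)"
      using False b[of "s - 1"] by (simp add: degree_bound_def)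
    ultimately have "real (num_cliques {..<n} E s m * degree_bound s n b m) \<le>
        real n powr (\<Sum>i<k. \<beta> i) * real n powr \<beta> (s - 1)"
      unfolding of_nat_mult by (intro mult_mono) auto
    also have "\<dots> \<le> real n powr x"
      unfolding powr_add[symmetric] using n x by (intro powr_mono) auto
    finally show ?thesis .
  qed
  then have "(\<Sum>m<k. real (num_cliques {..<n} E s m * degree_bound s n b m)) \<le> (\<Sum>m<k. real n powr x)"
    by (intro sum_mono) auto
  then show ?thesis by (simp only: of_nat_sum sum_constant card_lessThan)
qed

section \<open>Size of the fuel and running time\<close>

lemma powr_less_fuel:
  assumes "1 \<le> q" "1 \<le> n"
  shows "real n powr (real p / real q) < real (fuel p q n)"
proof (rule ccontr)
  assume "\<not> ?thesis"
  then have "real (fuel p q n) ^ q \<le> (real n powr (real p / real q)) ^ q"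
    by (intro power_mono) auto
  also have "\<dots> = real n powr real p"
    using assms by (simp add: powr_realpow[symmetric] powr_powr)
  also have "\<dots> = real n ^ p" using assms by (simp add: powr_realpow)
  finally have "fuel p q n ^ q \<le> n ^ p" by (simp flip: of_nat_power)
  with fuel_gt[OF assms(1), of n p] show False by simp
qed

lemma fuel_le_powr:
  assumes "1 \<le> q" "1 \<le> n"
  shows "real (fuel p q n) \<le> real n powr (real p / real q) + 1"
proof (rule ccontr)
  assume "\<not> ?thesis"
  then have "real n powr (real p / real q) < real (fuel p q n - 1)"
    using fuel_pos[OF assms(1), of p n] by (simp add: of_nat_diff)
  then have "(real n powr (real p / real q)) ^ q < real (fuel p q n - 1) ^ q"
    using assms by (intro power_strict_mono) auto
  moreover have "(real n powr (real p / real q)) ^ q = real n powr real p"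
    using assms by (simp add: powr_realpow[symmetric] powr_powr)
  moreover have "\<dots> = real n ^ p" using assms by (simp add: powr_realpow)
  ultimately have "n ^ p < (fuel p q n - 1) ^ q" by (simp flip: of_nat_power)
  with fuel_pred_le[OF assms(1), of p n] show False by simp
qed

text \<open>Some fixed power is all that is wanted: the bound enters the running time through its
  binary length, hence as a multiple of \<open>ln n\<close>.\<close>

lemma number_bound_le_power:
  assumes "2 \<le> n"
  shows "number_bound p q s n \<le> n ^ (s + 3 + (p + 2) * q)"
proof -
  let ?a = "s + 1 + (p + 2) * q"
  have mono: "n ^ i \<le> n ^ j" if "i \<le> j" for i j
    using assms that by (intro power_increasing) auto
  have 1: "2 * n ^ s \<le> n ^ Suc s" using assms by simp
  have "n ^ p + 2 \<le> n ^ (p + 2)"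
  proof -
    have "4 \<le> n * n" using mult_le_mono[OF assms assms] by simp
    then have "n ^ p * 4 \<le> n ^ p * (n * n)" by (rule mult_le_mono2)
    moreover have "1 \<le> n ^ p" using assms by simp
    ultimately have "n ^ p + 2 \<le> n ^ p * (n * n)" by linarith
    then show ?thesis by (simp add: power_add power2_eq_square mult_ac)
  qed
  then have "(n ^ p + 2) ^ q \<le> n ^ ((p + 2) * q)" unfolding power_mult by (rule power_mono) simp
  moreover have "n + 1 \<le> n ^ 2"
  proof -
    have "n + 1 \<le> 2 * n" using assms by simp
    also have "\<dots> \<le> n * n" using assms by simp
    finally show ?thesis by (simp add: power2_eq_square)
  qed
  ultimately have "(n + 1) * (n ^ p + 2) ^ q \<le> n ^ 2 * n ^ ((p + 2) * q)"
    by (intro mult_le_mono)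
  also have "\<dots> = n ^ (2 + (p + 2) * q)" by (rule power_add[symmetric])
  also have "\<dots> \<le> n ^ (s + 2 + (p + 2) * q)" by (rule mono) simp
  finally have 2: "(n + 1) * (n ^ p + 2) ^ q \<le> n ^ (s + 2 + (p + 2) * q)" .
  have 3: "2 * n ^ s + n \<le> n ^ (s + 2 + (p + 2) * q)"
  proof -
    have "2 * n ^ s + n \<le> n ^ Suc s + n ^ Suc s"
    proof (rule add_le_mono[OF 1])
      have "n ^ 1 \<le> n ^ Suc s" by (rule mono) simp
      then show "n \<le> n ^ Suc s" by (simp only: power_one_right)
    qed
    also have "\<dots> = n ^ Suc s * 2" by simp
    also have "\<dots> \<le> n ^ Suc s * n" by (rule mult_le_mono2[OF assms])
    also have "\<dots> = n ^ (s + 2)" by simp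
    also have "\<dots> \<le> n ^ (s + 2 + (p + 2) * q)" by (rule mono) simp
    finally show ?thesis .
  qed
  have "number_bound p q s n \<le> n ^ (s + 2 + (p + 2) * q) + n ^ (s + 2 + (p + 2) * q)"
    unfolding number_bound_def using 2 3 by linarith
  also have "\<dots> = n ^ (s + 2 + (p + 2) * q) * 2" by simp
  also have "\<dots> \<le> n ^ (s + 2 + (p + 2) * q) * n" by (rule mult_le_mono2[OF assms])
  also have "\<dots> = n ^ (s + 3 + (p + 2) * q)" by (simp add: power_add eval_nat_numeral)
  finally show ?thesis .
qed

lemma time_bound_soft_O:
  assumes q: "1 \<le> q" and e: "real s \<le> e" "real p / real q \<le> e"
  shows "(\<lambda>n. real (time_bound p q s k n)) \<in> soft_O (\<lambda>n. real n powr e)"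
proof -
  define A where "A = s + 3 + (p + 2) * q"
  define S where "S = com_size (clique_count p q s k)"
  define K where "K = real S * 6 * (4 + 3 * real A / ln 2)"
  have "real (time_bound p q s k n) \<le> K * (real n powr e * ln (real n))" if n: "3 \<le> n" for n
  proof -
    have ln: "1 \<le> ln (real n)"
    proof -
      have "exp 1 \<le> real n" using exp_le n by linarith
      then show ?thesis using n by (simp add: ln_ge_iff)
    qed
    have one: "1 \<le> real n powr e"
      using n e(1) by (intro ge_one_powr_ge_zero) auto
    have "real n ^ s \<le> real n powr e"
      using n e by (simp add: powr_realpow[symmetric])
    moreover have "real n powr (real p / real q) \<le> real n powr e"
      using n e by (intro powr_mono) auto
    then have "real (fuel p q n) \<le> real n powr e + 1"
      using fuel_le_powr[OF q, of n p] n by linarith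
    \<comment> \<open>With \<open>X = n powr e\<close> the left side is at most
      \<open>X + 2 * (X + 1) + 1 = 3 * X + 3\<close>, and \<open>1 \<le> X\<close>.\<close>
    ultimately have 1: "real (n ^ s + 2 * fuel p q n + 1) \<le> 6 * real n powr e"
      using one by simp
    have pos: "0 < number_bound p q s n" using n by (simp add: number_bound_def)
    have "real (len (number_bound p q s n)) \<le> log 2 (real (number_bound p q s n)) + 1"
      using pos unfolding floorlog_def by simp
    also have "log 2 (real (number_bound p q s n)) \<le> log 2 (real n ^ A)"
    proof -
      have "real (number_bound p q s n) \<le> real (n ^ A)"
        using number_bound_le_power[of n p q s] n unfolding A_def by (simp only: of_nat_le_iff)
      then show ?thesis using pos n by simp
    qed
    also have "\<dots> = real A / ln 2 * ln (real n)"
      using n by (simp add: log_def ln_realpow)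
    finally have "real (1 + 3 * len (number_bound p q s n)) \<le> 4 + 3 * real A / ln 2 * ln (real n)"
      by simp
    also have "\<dots> \<le> (4 + 3 * real A / ln 2) * ln (real n)"
      using ln by (simp add: algebra_simps)
    finally have 2: "real (1 + 3 * len (number_bound p q s n)) \<le> (4 + 3 * real A / ln 2) * ln (real n)" .
    have "real (time_bound p q s k n) = real S * real (n ^ s + 2 * fuel p q n + 1) *
        real (1 + 3 * len (number_bound p q s n))"
      unfolding time_bound_def S_def by (simp only: of_nat_mult)
    also have "\<dots> \<le> real S * (6 * real n powr e) * ((4 + 3 * real A / ln 2) * ln (real n))"
      by (intro mult_mono 1 2) (use ln in auto)
    finally show ?thesis by (simp add: K_def algebra_simps)
  qed
  then have "(\<lambda>n. real (time_bound p q s k n)) \<in> O(\<lambda>n. real n powr e * ln (real n) ^ 1)"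
    by (intro bigoI[of _ K] eventually_sequentiallyI[of 3]) (auto simp: abs_mult)
  then show ?thesis unfolding soft_O_def by blast
qed

section \<open>Arithmetic of the exponents and asymptotic estimates\<close>

lemma sum_choose_lessThan: "(\<Sum>i<m. i choose r) = m choose Suc r"
  by (induction m) auto

text \<open>\<open>i choose (s - 1)\<close> is monotone in \<open>i\<close>, so by the choice of
  \<tau> the terms are positive exactly for \<open>i \<le> \<tau>\<close>. The hockey-stick identity
  sums them.\<close>

lemma sum_positive_parts:
  fixes \<alpha> :: real
  assumes "0 < \<alpha>" "1 \<le> s" and "\<alpha> * real (\<tau> choose (s - 1)) < 1"
    and max: "\<And>t. \<alpha> * real (t choose (s - 1)) < 1 \<Longrightarrow> t \<le> \<tau>"
  shows "(\<Sum>i<k. max 0 (1 - \<alpha> * real (i choose (s - 1)))) =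
    real (min k (\<tau> + 1)) - \<alpha> * real (min k (\<tau> + 1) choose s)"
proof -
  let ?\<kappa> = "min k (\<tau> + 1)"
  have pos: "\<alpha> * real (i choose (s - 1)) < 1" if "i \<le> \<tau>" for i
  proof -
    have "\<alpha> * real (i choose (s - 1)) \<le> \<alpha> * real (\<tau> choose (s - 1))"
      using assms(1) binomial_right_mono[OF that, of "s - 1"] by simp
    with assms(3) show ?thesis by linarith
  qed
  have "(\<Sum>i<k. max 0 (1 - \<alpha> * real (i choose (s - 1)))) =
      (\<Sum>i<?\<kappa>. max 0 (1 - \<alpha> * real (i choose (s - 1))))"
  proof (rule sum.mono_neutral_right)
    show "\<forall>i\<in>{..<k} - {..<?\<kappa>}. max 0 (1 - \<alpha> * real (i choose (s - 1))) = 0"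
    proof
      fix i assume "i \<in> {..<k} - {..<?\<kappa>}"
      then have "\<not> i \<le> \<tau>" by auto
      then show "max 0 (1 - \<alpha> * real (i choose (s - 1))) = 0" using max[of i] by linarith
    qed
  qed auto
  also have "\<dots> = (\<Sum>i<?\<kappa>. 1 - \<alpha> * real (i choose (s - 1)))"
  proof (rule sum.cong)
    fix i assume "i \<in> {..<?\<kappa>}"
    then show "max 0 (1 - \<alpha> * real (i choose (s - 1))) = 1 - \<alpha> * real (i choose (s - 1))"
      using pos[of i] by simp
  qed simp
  also have "\<dots> = real ?\<kappa> - \<alpha> * real (\<Sum>i<?\<kappa>. i choose (s - 1))"
    by (simp add: sum_subtractf sum_distrib_left)
  also have "(\<Sum>i<?\<kappa>. i choose (s - 1)) = ?\<kappa> choose s"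
    using assms(2) by (simp add: sum_choose_lessThan)
  finally show ?thesis .
qed

text \<open>Normalising to \<open>1 \<le> K\<close> makes the powers of \<open>K\<close> grow with
  the exponent, so that one of them absorbs all the others.\<close>

lemma bigtheta_powr_bound:
  fixes c :: "nat \<Rightarrow> real"
  assumes "c \<in> \<Theta>(\<lambda>n. real n powr (- \<alpha>))"
  obtains K where "1 \<le> K" "\<forall>\<^sub>F n in sequentially. c n \<le> K * real n powr (- \<alpha>)"
proof -
  from assms have "c \<in> O(\<lambda>n. real n powr (- \<alpha>))" by blast
  then obtain K where K: "\<forall>\<^sub>F n in sequentially. norm (c n) \<le> K * norm (real n powr (- \<alpha>))"
    by (elim landau_o.bigE)
  have "\<forall>\<^sub>F n in sequentially. c n \<le> max 1 K * real n powr (- \<alpha>)"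
    using K
  proof (rule eventually_mono)
    fix n assume "norm (c n) \<le> K * norm (real n powr (- \<alpha>))"
    then have "c n \<le> K * real n powr (- \<alpha>)" by simp
    also have "\<dots> \<le> max 1 K * real n powr (- \<alpha>)" by (intro mult_right_mono) auto
    finally show "c n \<le> max 1 K * real n powr (- \<alpha>)" .
  qed
  then show ?thesis by (intro that[of "max 1 K"]) auto
qed

text \<open>The factor \<open>n powr \<delta>\<close> swallows the constants, as
  \<open>2 ^ k\<close> bounds every \<open>j choose r\<close>. The \<open>max 0\<close> keeps the
  threshold at least \<open>n powr \<delta>\<close> even where the mean is far below 1; the tail
  bound would not be negligible otherwise.\<close>

lemma expected_extensions_le:
  fixes \<alpha> c K :: real
  assumes n: "1 \<le> n" and c: "0 \<le> c" "c \<le> K * real n powr (- \<alpha>)" and K: "1 \<le> K"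
    and \<delta>: "2 * exp 1 * K ^ (2 ^ k) \<le> real n powr \<delta>" and j: "j < k"
  shows "2 * exp 1 * (real n * c ^ (j choose r)) \<le>
    real n powr (\<delta> + max 0 (1 - \<alpha> * real (j choose r)))"
proof -
  let ?C = "j choose r"
  have "?C \<le> 2 ^ k"
  proof -
    have "?C \<le> 2 ^ j" by (rule binomial_le_pow2)
    also have "\<dots> \<le> 2 ^ k" using j by (intro power_increasing) auto
    finally show ?thesis .
  qed
  have "c ^ ?C \<le> (K * real n powr (- \<alpha>)) ^ ?C" by (rule power_mono[OF c(2,1)])
  also have "\<dots> = K ^ ?C * real n powr (- \<alpha> * real ?C)"
    using n by (simp add: power_mult_distrib powr_realpow[symmetric] powr_powr)
  also have "\<dots> \<le> K ^ (2 ^ k) * real n powr (- \<alpha> * real ?C)"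
    using K \<open>?C \<le> 2 ^ k\<close> by (intro mult_right_mono power_increasing) auto
  finally have "real n * c ^ ?C \<le> real n * (K ^ (2 ^ k) * real n powr (- \<alpha> * real ?C))"
    by (rule mult_left_mono) simp
  also have "\<dots> = K ^ (2 ^ k) * real n powr (1 - \<alpha> * real ?C)"
    using n by (simp add: powr_diff powr_minus field_simps)
  also have "\<dots> \<le> K ^ (2 ^ k) * real n powr (max 0 (1 - \<alpha> * real ?C))"
    using n K by (intro mult_left_mono powr_mono) auto
  finally have "2 * exp 1 * (real n * c ^ ?C) \<le>
      2 * exp 1 * (K ^ (2 ^ k) * real n powr (max 0 (1 - \<alpha> * real ?C)))"
    by (rule mult_left_mono) simp
  also have "\<dots> = 2 * exp 1 * K ^ (2 ^ k) * real n powr (max 0 (1 - \<alpha> * real ?C))" by simp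
  also have "\<dots> \<le> real n powr \<delta> * real n powr (max 0 (1 - \<alpha> * real ?C))"
    by (rule mult_right_mono[OF \<delta>]) simp
  finally show ?thesis by (simp add: powr_add)
qed

lemma negligible_stretched_exponential:
  fixes \<delta> :: real
  assumes "0 < \<delta>"
  shows "negligible_fun (\<lambda>n. real k * real n ^ k * (1 / 2) powr (real n powr \<delta>))"
  unfolding negligible_fun_def
proof
  fix d :: nat
  show "(\<lambda>n. real k * real n ^ k * (1 / 2) powr (real n powr \<delta>)) \<in> O(\<lambda>n. 1 / real n ^ d)"
    using assms by real_asymp
qed

lemma obtain_fraction_between:
  fixes x y :: real
  assumes "0 \<le> x" "x < y"
  obtains p q :: nat where "1 \<le> q" "x < real p / real q" "real p / real q < y"
proof -
  obtain r where r: "r \<in> \<rat>" "x < r" "r < y" using Rats_dense_in_real[OF assms(2)] by blast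
  obtain p q :: nat where "q \<noteq> 0" "\<bar>r\<bar> = real p / real q"
    using Rats_abs_nat_div_natE[OF r(1)] by metis
  with r assms show ?thesis by (intro that[of q p]) auto
qed

text \<open>Both cases of the theorem are one statement in
  \<open>min k (\<tau> + 1)\<close>.\<close>

lemma clique_counting:
  fixes k s \<tau> :: nat and \<alpha> :: real and c :: "nat \<Rightarrow> real"
  assumes s: "2 \<le> s" "s \<le> k" and \<alpha>: "0 < \<alpha>" "\<alpha> < 1"
    and c: "\<And>n. 0 \<le> c n" "\<And>n. c n \<le> 1" "c \<in> \<Theta>(\<lambda>n. real n powr (- \<alpha>))"
    and \<tau>: "\<alpha> * real (\<tau> choose (s - 1)) < 1" "\<And>t::nat. \<alpha> * real (t choose (s - 1)) < 1 \<Longrightarrow> t \<le> \<tau>"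
    and e: "e = real (min k (\<tau> + 1)) + 1 - \<alpha> * real (min k (\<tau> + 1) choose s)"
  shows "\<exists>P T \<epsilon>. runs_in_time P s T \<and> (\<lambda>n. real (T n)) \<in> soft_O (\<lambda>n. real n powr e)
       \<and> negligible_fun \<epsilon> \<and> (\<forall>n. success_prob P k s T c n \<ge> 1 - \<epsilon> n)"
proof -
  define w where "w i = max 0 (1 - \<alpha> * real (i choose (s - 1)))" for i
  \<comment> \<open>The exponent of the work contains the \<open>k\<close> terms
    \<open>\<beta> j\<close> and once more \<open>\<beta> (s - 1)\<close>, so the losses add up to
    \<open>\<alpha> / 2\<close>.\<close>
  define \<delta> where "\<delta> = \<alpha> / (2 * (real k + 1))"
  define \<beta> where "\<beta> i = \<delta> + w i" for i
  define x where "x = max (real s) (e - \<alpha> / 2)"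
  have \<delta>: "0 < \<delta>" "(real k + 1) * \<delta> = \<alpha> / 2"
    using \<alpha> by (simp_all add: \<delta>_def field_simps add_pos_pos)
  have \<beta>: "0 \<le> \<beta> i" "\<delta> \<le> \<beta> i" for i using \<delta> by (simp_all add: \<beta>_def w_def)
  have sum_w: "(\<Sum>i<k. w i) = e - 1"
    using sum_positive_parts[OF \<alpha>(1) _ \<tau>, of k] s by (simp add: w_def e)
  have w_s: "w (s - 1) = 1 - \<alpha>" using \<alpha> by (simp add: w_def)
  \<comment> \<open>The first \<open>s - 1\<close> increments are 1, since their binomials vanish,
    and the next one is \<open>1 - \<alpha>\<close>; hence
    \<open>e - 1 \<ge> s - \<alpha> > s - 1\<close>.\<close>
  have "real s < e"
  proof -
    have "(\<Sum>i<s - 1. w i) = (\<Sum>i<s - 1. 1)"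
      by (rule sum.cong) (auto simp: w_def binomial_eq_0)
    then have "(\<Sum>i<Suc (s - 1). w i) = real s - \<alpha>"
      unfolding sum.lessThan_Suc using s w_s by (simp add: of_nat_diff)
    moreover have "(\<Sum>i<Suc (s - 1). w i) \<le> (\<Sum>i<k. w i)"
      using s by (intro sum_mono2) (auto simp: w_def)
    ultimately show ?thesis using sum_w \<alpha> by linarith
  qed
  then have "x < e" using \<alpha> by (simp add: x_def)
  have "0 \<le> x" by (simp add: x_def)
  from obtain_fraction_between[OF this \<open>x < e\<close>] obtain p q :: nat where q: "1 \<le> q" and pq: "x < real p / real q" "real p / real q < e"
    by blast
  have work: "(\<Sum>j<k. \<beta> j) + \<beta> (s - 1) \<le> x"
  proof -
    have "(\<Sum>j<k. \<beta> j) + \<beta> (s - 1) = (real k + 1) * \<delta> + (\<Sum>j<k. w j) + w (s - 1)"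
      by (simp add: \<beta>_def sum.distrib algebra_simps)
    also have "\<dots> = e - \<alpha> / 2" unfolding \<delta> sum_w w_s by simp
    finally show ?thesis by (simp add: x_def)
  qed
  let ?P = "clique_count p q s k" and ?T = "time_bound p q s k"
  \<comment> \<open>With the failure probability itself as error the required inequality holds for
    every \<open>n\<close>, and only eventual decay remains to be shown.\<close>
  let ?\<epsilon> = "\<lambda>n. 1 - success_prob ?P k s ?T c n"
  let ?b = "\<lambda>n j. real n powr \<beta> j"
  obtain K where K: "1 \<le> K" "\<forall>\<^sub>F n in sequentially. c n \<le> K * real n powr (- \<alpha>)"
    using bigtheta_powr_bound[OF c(3)] by blast
  have ev1: "\<forall>\<^sub>F n in sequentially. 2 * exp 1 * K ^ (2 ^ k) \<le> real n powr \<delta>"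
  proof -
    have "filterlim (\<lambda>n::nat. real n powr \<delta>) at_top sequentially" using \<delta>(1) by real_asymp
    then show ?thesis unfolding filterlim_at_top by blast
  qed
  \<comment> \<open>The strict gap between \<open>x\<close> and \<open>p / q\<close> absorbs the
    factor \<open>k\<close> that comes from summing over the depths.\<close>
  have ev2: "\<forall>\<^sub>F n in sequentially. real k * real n powr x < real n powr (real p / real q)"
    using pq(1) by real_asymp
  have fail: "\<forall>\<^sub>F n in sequentially. ?\<epsilon> n \<le> real k * real n ^ k * (1 / 2) powr (real n powr \<delta>)"
    using K(2) ev1 ev2 eventually_ge_at_top[of 1]
  proof eventually_elim
    case (elim n)
    let ?G = "\<lambda>E. few_extensions n E s k (?b n)"
    let ?M = "ER_hypergraph n (c n) s"
    have "measure_pmf.prob ?M {E. ?G E} \<le> success_prob ?P k s ?T c n"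
    proof (rule success_prob_ge)
      fix E
      show "\<exists>R M t. steps (?T n) (init_config ?P s n E) = return_pmf ([], R, M, t) \<and>
        (?G E \<longrightarrow> R 0 = num_cliques {..<n} E s k)"
      proof (cases "?G E")
        case True
        have "card (candidates n E s vs) \<le> degree_bound s n (?b n) (length vs)"
          if "ordered_clique n E s vs" for vs
          by (rule card_candidates_le[OF True]) (use s that in auto)
        from clique_count_steps[OF s(1) q, of n E k, OF this, of p] obtain R M t where
          R: "steps (?T n) (init_config ?P s n E) = return_pmf ([], R, M, t)"
          "(\<Sum>m<k. num_cliques {..<n} E s m * degree_bound s n (?b n) m) < fuel p q n \<Longrightarrow>
            R 0 = num_cliques {..<n} E s k" by auto
        have "real (\<Sum>m<k. num_cliques {..<n} E s m * degree_bound s n (?b n) m) \<le> real k * real n powr x"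
          by (rule search_work_le[OF elim(4) True s(1) refl \<beta>(1) _ work]) (simp add: x_def)
        also have "\<dots> < real (fuel p q n)"
          using elim(3) powr_less_fuel[OF q elim(4), of p] by linarith
        finally have "(\<Sum>m<k. num_cliques {..<n} E s m * degree_bound s n (?b n) m) < fuel p q n"
          by (simp only: of_nat_less_iff)
        then show ?thesis using R by blast
      next
        case False
        have "card (candidates n E s vs) \<le> n" for vs
          using card_mono[of "{..<n}" "candidates n E s vs"] by (auto simp: candidates_def)
        from clique_count_steps[OF s(1) q, of n E k "\<lambda>_. n" p, OF this] False show ?thesis by blast
      qed
    qed
    moreover have "measure_pmf.prob ?M {E. \<not> ?G E} \<le> real k * real n ^ k * (1 / 2) powr (real n powr \<delta>)"
    proof (rule prob_not_few_extensions[OF elim(4) c(1,2)])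
      show "1 \<le> s" using s by simp
      fix j assume "j < k"
      then show "2 * exp 1 * (real n * c n ^ (j choose (s - 1))) \<le> ?b n j"
        unfolding \<beta>_def w_def by (rule expected_extensions_le[OF elim(4) c(1) elim(1) K(1) elim(2)])
      show "real n powr \<delta> \<le> ?b n j" using elim(4) \<beta>(2) by (intro powr_mono) auto
    qed simp
    moreover have "measure_pmf.prob ?M {E. \<not> ?G E} = 1 - measure_pmf.prob ?M {E. ?G E}"
      using measure_pmf.prob_compl[of "{E. ?G E}" ?M] by (simp add: Compl_eq_Diff_UNIV[symmetric] Collect_neg_eq)
    ultimately show ?case by linarith
  qed
  have "?\<epsilon> \<in> O(\<lambda>n. real k * real n ^ k * (1 / 2) powr (real n powr \<delta>))"
  proof (rule bigoI[of _ 1], rule eventually_mono[OF fail])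
    fix n assume "?\<epsilon> n \<le> real k * real n ^ k * (1 / 2) powr (real n powr \<delta>)"
    moreover have "0 \<le> ?\<epsilon> n" using success_prob_le_1 by simp
    ultimately show "norm (?\<epsilon> n) \<le> 1 * norm (real k * real n ^ k * (1 / 2) powr (real n powr \<delta>))"
      by simp
  qed
  then have "negligible_fun ?\<epsilon>"
    using negligible_stretched_exponential[OF \<delta>(1), of k] landau_o.big_trans
    unfolding negligible_fun_def by blast
  moreover have "runs_in_time ?P s ?T" by (rule runs_in_time_clique_count[OF s(1) q])
  moreover have "(\<lambda>n. real (?T n)) \<in> soft_O (\<lambda>n. real n powr e)"
    by (rule time_bound_soft_O[OF q]) (use pq \<open>real s < e\<close> in auto)
  ultimately show ?thesis by (intro exI[of _ ?P] exI[of _ ?T] exI[of _ ?\<epsilon>]) auto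
qed

theorem corollary5p3:
  fixes k s \<tau> :: nat and \<alpha> :: real and c :: "nat \<Rightarrow> real"
  assumes "2 \<le> s" and "s \<le> k"
    and "0 < \<alpha>" and "\<alpha> < 1"
    and "\<And>n. 0 \<le> c n" and "\<And>n. c n \<le> 1"
    and "c \<in> \<Theta>(\<lambda>n. real n powr (- \<alpha>))"
    and "\<alpha> * real (\<tau> choose (s - 1)) < 1"
    and "\<And>t::nat. \<alpha> * real (t choose (s - 1)) < 1 \<Longrightarrow> t \<le> \<tau>"
  shows "(k \<ge> \<tau> + 1 \<longrightarrow>
            (\<exists>P T \<epsilon>. runs_in_time P s T
               \<and> (\<lambda>n. real (T n)) \<in> soft_O (\<lambda>n. real n powr (real \<tau> + 2 - \<alpha> * real ((\<tau> + 1) choose s)))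
               \<and> negligible_fun \<epsilon> \<and> (\<forall>n. success_prob P k s T c n \<ge> 1 - \<epsilon> n)))
       \<and> (k < \<tau> + 1 \<longrightarrow>
            (\<exists>P T \<epsilon>. runs_in_time P s T
               \<and> (\<lambda>n. real (T n)) \<in> soft_O (\<lambda>n. real n powr (real k + 1 - \<alpha> * real (k choose s)))
               \<and> negligible_fun \<epsilon> \<and> (\<forall>n. success_prob P k s T c n \<ge> 1 - \<epsilon> n)))"
proof (intro conjI impI)
  assume "k \<ge> \<tau> + 1"
  then show "\<exists>P T \<epsilon>. runs_in_time P s T
      \<and> (\<lambda>n. real (T n)) \<in> soft_O (\<lambda>n. real n powr (real \<tau> + 2 - \<alpha> * real ((\<tau> + 1) choose s)))
      \<and> negligible_fun \<epsilon> \<and> (\<forall>n. success_prob P k s T c n \<ge> 1 - \<epsilon> n)"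
    by (intro clique_counting[OF assms]) simp_all
next
  assume "k < \<tau> + 1"
  then show "\<exists>P T \<epsilon>. runs_in_time P s T
      \<and> (\<lambda>n. real (T n)) \<in> soft_O (\<lambda>n. real n powr (real k + 1 - \<alpha> * real (k choose s)))
      \<and> negligible_fun \<epsilon> \<and> (\<forall>n. success_prob P k s T c n \<ge> 1 - \<epsilon> n)"
    by (intro clique_counting[OF assms]) simp_all
qed

end
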